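(* Let $d\ge1$ and let $m>n\ge1$ be coprime integers. Then $$\tilde{\mathbf{p}}_u=\mathbf{p}_u\circ\Phi_d,\qquad\mathbf{p}_u=\tilde{\mathbf{p}}_u\circ\Psi_d,\qquad\forall\,1\le u\le d-1.$$ Moreover, $\Phi_d:\mathcal{A}dm(dn,dm)\to\mathcal{Y}(dn,dm)$ and $\Psi_d:\mathcal{Y}(dn,dm)\to\mathcal{A}dm(dn,dm)$ are inverse to each other. In particular, for any $D\in\mathcal{Y}(dn,dm)$ with $\Delta=\Psi_d(D)\in\mathcal{A}dm(dn,dm)$, we have $$\mathbf{i}_{j,u}=\tilde{\mathbf{i}}_{j,u},\qquad\mathbf{s}_{j,u}=\tilde{\mathbf{s}}_{j,u},\qquad\mathbf{s}_j=\tilde{\mathbf{s}}_j,\qquad\forall\,0\le j\le n-1,\ 1\le u\le d-1,$$ where the objects without tilde are those attached to $D$ and the objects with tilde are those attached to $\Delta$.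
   Context: Notation: $\mathbb{N}=\{0,1,\dots\}$. Indices run over $0\le i\le d-1$, $0\le j\le n-1$; a family indexed by $(i,j)$ is also indexed by $x=in+j$. A cycle $(a\ \cdots\ u)$ with $0\le a\le u$ denotes the permutation of $\{0,\dots,d-1\}$ with $i\mapsto i+1$ for $a\le i<u$, $u\mapsto a$, and all other elements fixed. $\Gamma\subset\mathbb{N}$ is the semigroup (with $0$) generated by $dn,dm,dmn+1$; $\hat a_{i,j}=jdm+(dmn+1)i$; $a_{i,j}=a_{in+j}=mi+\lfloor jm/n\rfloor$. $\mathcal{A}dm(dn,dm)$ is the set of $\Delta\subset\mathbb{N}$ with $\min\Delta=0$, $\Gamma+\Delta\subset\Delta$, such that for every $0\le i\le d-1$ there is $a\in A(\Delta)$ with $a\equiv i\pmod d$ and $a+dm+1\in\Delta$, where $\Delta=\bigsqcup_{a\in A(\Delta)}(a+dn\mathbb{N})$. One writes uniquely $A(\Delta)=\{\hat a_{i,j}-dn\,c_{i,j}\}$, $0\le c_{i,j}\le a_{i,j}$, and identifies $\Delta$ with $(c_{i,j})$. $\mathcal{Y}(dn,dm)$ is the set of integer families $(y_x)_{0\le x\le dn-1}$ with $0\le y_x\le a_x$ and $y_x\le y_{x+1}$. Objects attached to $D=(y_{i,j})\in\mathcal{Y}(dn,dm)$. Set $\mathrm{rk}^{[0]}_x=mx-ny_x$. For $u=d-1,\dots,1$, given $(\mathrm{rk}^{[d-u-1]}_x)_{0\le x\le(u+1)n-1}$ put $\mathbf{p}_u=\max\{0\le x\le un:\mathrm{rk}^{[d-u-1]}_x\le\mathrm{rk}^{[d-u-1]}_{x+n-1}+m\}$,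 and for $0\le x\le un-1$ set $\mathrm{rk}^{[d-u]}_x=\mathrm{rk}^{[d-u-1]}_x$ if $x<\mathbf{p}_u$, $\mathrm{rk}^{[d-u]}_x=\mathrm{rk}^{[d-u-1]}_{x+n}$ if $x\ge\mathbf{p}_u$. Put $\mathbf{i}_{j,u}=\min\{0\le i\le u:in+j\ge\mathbf{p}_u\}$, $\mathbf{s}_{j,u}=(\mathbf{i}_{j,u}\ \cdots\ u)$, $\mathbf{s}_j=\mathbf{s}_{j,d-1}\circ\cdots\circ\mathbf{s}_{j,1}$, and $\Psi_d((y_{i,j}))=(c_{i,j})$ with $c_{i,j}=y_{\mathbf{s}_j(i),j}-(\mathbf{s}_j(i)-i)m$. Objects attached to $\Delta=(c_{i,j})\in\mathcal{A}dm(dn,dm)$. Set $\mathrm{rk}^{[0]}_{\Delta,in+j}=\mathrm{rk}^{[0]}_{\Delta,i,j}=m(in+j)-nc_{i,j}$. For $u=1,\dots,d-1$, given $(\mathrm{rk}^{[u-1]}_{\Delta,i,j})$ (convention $\mathrm{rk}^{[u-1]}_{\Delta,u,n}:=\mathrm{rk}^{[u-1]}_{\Delta,u,0}$), put $\tilde{\mathbf{p}}_u=\max\{in+j+1:0\le i\le u-1,\ 0\le j\le n-1,\ \mathrm{rk}^{[u-1]}_{\Delta,u,j+1}\le\mathrm{rk}^{[u-1]}_{\Delta,i,j}+m\}$, and for $x=in+j$ set: $\mathrm{rk}^{[u]}_{\Delta,x}=\mathrm{rk}^{[u-1]}_{\Delta,x}$ if $0\le x<\tilde{\mathbf{p}}_u$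 or $(u+1)n\le x<dn$; $\mathrm{rk}^{[u]}_{\Delta,x}=\mathrm{rk}^{[u-1]}_{\Delta,un+j}$ if $\tilde{\mathbf{p}}_u\le x<\tilde{\mathbf{p}}_u+n$; $\mathrm{rk}^{[u]}_{\Delta,x}=\mathrm{rk}^{[u-1]}_{\Delta,x-n}$ if $\tilde{\mathbf{p}}_u+n\le x<(u+1)n$. Put $\tilde{\mathbf{i}}_{j,u}=\min\{0\le i\le u:in+j\ge\tilde{\mathbf{p}}_u\}$, $\tilde{\mathbf{s}}_{j,u}=(\tilde{\mathbf{i}}_{j,u}\ \cdots\ u)$, $\tilde{\mathbf{s}}_j=\tilde{\mathbf{s}}_{j,d-1}\circ\cdots\circ\tilde{\mathbf{s}}_{j,1}$, and $\Phi_d((c_{i,j}))=(c^{[d-1]}_{i,j})$ with $c^{[d-1]}_{i,j}=c_{\tilde{\mathbf{s}}_j^{-1}(i),j}-(\tilde{\mathbf{s}}_j^{-1}(i)-i)m$. All these objects are well-defined, with $\Psi_d$ taking values in $\mathcal{A}dm(dn,dm)$ and $\Phi_d$ in $\mathcal{Y}(dn,dm)$. *)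

theory Defs
  imports "HOL-Number_Theory.Cong" "HOL-Library.FuncSet" "HOL-Library.Disjoint_Sets"
begin

text \<open>
  Families indexed by pairs \<open>(i, j)\<close> with \<open>i < d\<close>, \<open>j < n\<close> are functions of the single index
  \<open>x = i * n + j\<close>, so \<open>i = x div n\<close> and \<open>j = x mod n\<close>. A family is an extensional function on
  \<open>{..<d * n}\<close> (value \<open>undefined\<close> elsewhere), so that equality of functions is equality of families.
\<close>

definition cyc :: "nat \<Rightarrow> nat \<Rightarrow> nat \<Rightarrow> nat" where
  "cyc a u i = (if a \<le> i \<and> i < u then i + 1 else if i = u then a else i)"


section \<open>Admissible subsets and their coordinates\<close>

inductive_set Gam :: "nat \<Rightarrow> nat \<Rightarrow> nat \<Rightarrow> nat set" for d n m where
  Gam_zero: "0 \<in> Gam d n m"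
| Gam_gen: "g \<in> {d * n, d * m, d * m * n + 1} \<Longrightarrow> g \<in> Gam d n m"
| Gam_add: "g \<in> Gam d n m \<Longrightarrow> h \<in> Gam d n m \<Longrightarrow> g + h \<in> Gam d n m"

definition hat_a :: "nat \<Rightarrow> nat \<Rightarrow> nat \<Rightarrow> nat \<Rightarrow> nat \<Rightarrow> nat" where
  "hat_a d n m i j = j * d * m + (d * m * n + 1) * i"

definition bnd :: "nat \<Rightarrow> nat \<Rightarrow> nat \<Rightarrow> nat" where
  "bnd n m x = m * (x div n) + ((x mod n) * m) div n"

definition ray :: "nat \<Rightarrow> nat \<Rightarrow> nat \<Rightarrow> nat set" where
  "ray d n a = {a + d * n * k | k. True}"

text \<open>The set \<open>A(\<Delta>)\<close> of \<open>dn\<close>-generators; the lemma below shows that it is well-defined.\<close>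

definition gens :: "nat \<Rightarrow> nat \<Rightarrow> nat set \<Rightarrow> nat set" where
  "gens d n \<Delta> = (THE A. \<Delta> = (\<Union>a\<in>A. ray d n a) \<and> disjoint_family_on (ray d n) A)"

definition Adm :: "nat \<Rightarrow> nat \<Rightarrow> nat \<Rightarrow> nat set set" where
  "Adm d n m = {\<Delta>. 0 \<in> \<Delta> \<and> (\<forall>g\<in>Gam d n m. \<forall>b\<in>\<Delta>. g + b \<in> \<Delta>) \<and>
     (\<forall>i<d. \<exists>a\<in>gens d n \<Delta>. [a = i] (mod d) \<and> a + d * m + 1 \<in> \<Delta>)}"

text \<open>The identification of \<open>\<Delta>\<close> with its family \<open>(c\<^sub>i\<^sub>,\<^sub>j)\<close>, in both directions.\<close>

definition coord :: "nat \<Rightarrow> nat \<Rightarrow> nat \<Rightarrow> nat set \<Rightarrow> nat \<Rightarrow> int" where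
  "coord d n m \<Delta> = (THE c. c \<in> (\<Pi>\<^sub>E x\<in>{..<d * n}. {0..int (bnd n m x)}) \<and>
     int ` gens d n \<Delta> =
       {int (hat_a d n m i j) - int (d * n) * c (i * n + j) | i j. i < d \<and> j < n})"

definition of_coord :: "nat \<Rightarrow> nat \<Rightarrow> nat \<Rightarrow> (nat \<Rightarrow> int) \<Rightarrow> nat set" where
  "of_coord d n m c = {b. \<exists>i<d. \<exists>j<n. \<exists>k::nat.
     int b = int (hat_a d n m i j) - int (d * n) * c (i * n + j) + int (d * n) * int k}"

definition Yset :: "nat \<Rightarrow> nat \<Rightarrow> nat \<Rightarrow> (nat \<Rightarrow> int) set" where
  "Yset d n m = {y \<in> (\<Pi>\<^sub>E x\<in>{..<d * n}. {0..int (bnd n m x)}).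
     \<forall>x. x + 1 < d * n \<longrightarrow> y x \<le> y (x + 1)}"


section \<open>Index and permutation determined by the value \<open>p\<close> at step \<open>u\<close>\<close>

definition idx :: "nat \<Rightarrow> nat \<Rightarrow> nat \<Rightarrow> nat \<Rightarrow> nat" where
  "idx n p j u = Min {i. i \<le> u \<and> p \<le> i * n + j}"

text \<open>\<open>s (d - 1) \<circ> \<dots> \<circ> s 1\<close>\<close>

definition comp_perm :: "nat \<Rightarrow> (nat \<Rightarrow> nat \<Rightarrow> nat) \<Rightarrow> nat \<Rightarrow> nat" where
  "comp_perm d s = fold (\<lambda>u f. s u \<circ> f) [1..<d] id"


section \<open>Objects attached to \<open>D = (y\<^sub>i\<^sub>,\<^sub>j)\<close>\<close>

definition p_step :: "nat \<Rightarrow> nat \<Rightarrow> nat \<Rightarrow> (nat \<Rightarrow> int) \<Rightarrow> nat" where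
  "p_step n m u r = Max {x. x \<le> u * n \<and> r x \<le> r (x + n - 1) + int m}"

text \<open>
  \<open>rk d n m y k\<close> is the family with superscript \<open>[k]\<close>; the step from \<open>k = d - u - 1\<close> to
  \<open>Suc k = d - u\<close> uses \<open>u = d - Suc k\<close>. Values beyond the stated range \<open>x < (d - k) * n\<close> are
  irrelevant and never used.
\<close>

primrec rk :: "nat \<Rightarrow> nat \<Rightarrow> nat \<Rightarrow> (nat \<Rightarrow> int) \<Rightarrow> nat \<Rightarrow> nat \<Rightarrow> int" where
  "rk d n m y 0 = (\<lambda>x. int m * int x - int n * y x)"
| "rk d n m y (Suc k) = (\<lambda>x.
     if x < p_step n m (d - Suc k) (rk d n m y k) then rk d n m y k x else rk d n m y k (x + n))"

definition p_of :: "nat \<Rightarrow> nat \<Rightarrow> nat \<Rightarrow> (nat \<Rightarrow> int) \<Rightarrow> nat \<Rightarrow> nat" where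
  "p_of d n m y u = p_step n m u (rk d n m y (d - u - 1))"

definition i_of :: "nat \<Rightarrow> nat \<Rightarrow> nat \<Rightarrow> (nat \<Rightarrow> int) \<Rightarrow> nat \<Rightarrow> nat \<Rightarrow> nat" where
  "i_of d n m y j u = idx n (p_of d n m y u) j u"

definition s_step :: "nat \<Rightarrow> nat \<Rightarrow> nat \<Rightarrow> (nat \<Rightarrow> int) \<Rightarrow> nat \<Rightarrow> nat \<Rightarrow> nat \<Rightarrow> nat" where
  "s_step d n m y j u = cyc (i_of d n m y j u) u"

definition s_of :: "nat \<Rightarrow> nat \<Rightarrow> nat \<Rightarrow> (nat \<Rightarrow> int) \<Rightarrow> nat \<Rightarrow> nat \<Rightarrow> nat" where
  "s_of d n m y j = comp_perm d (s_step d n m y j)"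

definition Psi_coord :: "nat \<Rightarrow> nat \<Rightarrow> nat \<Rightarrow> (nat \<Rightarrow> int) \<Rightarrow> nat \<Rightarrow> int" where
  "Psi_coord d n m y = (\<lambda>x\<in>{..<d * n}. let i = x div n; j = x mod n; i' = s_of d n m y j i
     in y (i' * n + j) - (int i' - int i) * int m)"

definition Psi :: "nat \<Rightarrow> nat \<Rightarrow> nat \<Rightarrow> (nat \<Rightarrow> int) \<Rightarrow> nat set" where
  "Psi d n m y = of_coord d n m (Psi_coord d n m y)"


section \<open>Objects attached to \<open>\<Delta> = (c\<^sub>i\<^sub>,\<^sub>j)\<close>\<close>

text \<open>The conditional implements the convention that index \<open>(u, n)\<close> stands for \<open>(u, 0)\<close>.\<close>

definition pt_step :: "nat \<Rightarrow> nat \<Rightarrow> nat \<Rightarrow> (nat \<Rightarrow> int) \<Rightarrow> nat" where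
  "pt_step n m u r = Max {i * n + j + 1 | i j. i < u \<and> j < n \<and>
     (if j + 1 = n then r (u * n) else r (u * n + (j + 1))) \<le> r (i * n + j) + int m}"

primrec rkt :: "nat \<Rightarrow> nat \<Rightarrow> nat \<Rightarrow> nat set \<Rightarrow> nat \<Rightarrow> nat \<Rightarrow> int" where
  "rkt d n m \<Delta> 0 = (\<lambda>x. int m * int x - int n * coord d n m \<Delta> x)"
| "rkt d n m \<Delta> (Suc k) = (\<lambda>x. let u = Suc k; r = rkt d n m \<Delta> k; p = pt_step n m u r in
     if x < p \<or> (u + 1) * n \<le> x then r x
     else if x < p + n then r (u * n + x mod n)
     else r (x - n))"

definition pt_of :: "nat \<Rightarrow> nat \<Rightarrow> nat \<Rightarrow> nat set \<Rightarrow> nat \<Rightarrow> nat" where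
  "pt_of d n m \<Delta> u = pt_step n m u (rkt d n m \<Delta> (u - 1))"

definition it_of :: "nat \<Rightarrow> nat \<Rightarrow> nat \<Rightarrow> nat set \<Rightarrow> nat \<Rightarrow> nat \<Rightarrow> nat" where
  "it_of d n m \<Delta> j u = idx n (pt_of d n m \<Delta> u) j u"

definition st_step :: "nat \<Rightarrow> nat \<Rightarrow> nat \<Rightarrow> nat set \<Rightarrow> nat \<Rightarrow> nat \<Rightarrow> nat \<Rightarrow> nat" where
  "st_step d n m \<Delta> j u = cyc (it_of d n m \<Delta> j u) u"

definition st_of :: "nat \<Rightarrow> nat \<Rightarrow> nat \<Rightarrow> nat set \<Rightarrow> nat \<Rightarrow> nat \<Rightarrow> nat" where
  "st_of d n m \<Delta> j = comp_perm d (st_step d n m \<Delta> j)"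

definition Phi :: "nat \<Rightarrow> nat \<Rightarrow> nat \<Rightarrow> nat set \<Rightarrow> nat \<Rightarrow> int" where
  "Phi d n m \<Delta> = (\<lambda>x\<in>{..<d * n}. let i = x div n; j = x mod n; i' = inv (st_of d n m \<Delta> j) i
     in coord d n m \<Delta> (i' * n + j) - (int i' - int i) * int m)"


section \<open>Well-definedness of \<open>gens\<close>\<close>

lemma ray_decomposition_eq:
  assumes pos: "0 < d * n"
    and eq: "\<Delta> = (\<Union>a\<in>A. ray d n a)" and disj: "disjoint_family_on (ray d n) A"
  shows "A = {a \<in> \<Delta>. \<forall>b\<in>\<Delta>. a \<noteq> b + d * n}"
proof (intro equalityI subsetI)
  fix a assume a: "a \<in> A"
  have "a \<in> ray d n a" by (force simp: ray_def)
  moreover have "a \<noteq> b + d * n" if "b \<in> \<Delta>" for b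
  proof
    assume ab: "a = b + d * n"
    from that eq obtain a' k where a': "a' \<in> A" "b = a' + d * n * k" by (auto simp: ray_def)
    then have "a = a' + d * n * Suc k" using ab by simp
    then have "a \<in> ray d n a'" unfolding ray_def by blast
    with \<open>a \<in> ray d n a\<close> disj a a'(1) have "a = a'" by (auto simp: disjoint_family_on_def)
    with \<open>a = a' + d * n * Suc k\<close> pos show False by simp
  qed
  ultimately show "a \<in> {a \<in> \<Delta>. \<forall>b\<in>\<Delta>. a \<noteq> b + d * n}" using a eq by blast
next
  fix a assume a: "a \<in> {a \<in> \<Delta>. \<forall>b\<in>\<Delta>. a \<noteq> b + d * n}"
  then obtain a' k where a': "a' \<in> A" "a = a' + d * n * k" using eq by (auto simp: ray_def)
  show "a \<in> A"
  proof (cases k)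
    case 0
    then show ?thesis using a' by simp
  next
    case (Suc l)
    have "a' + d * n * l \<in> \<Delta>" using a'(1) eq by (auto simp: ray_def)
    moreover have "a = (a' + d * n * l) + d * n" using a' Suc by simp
    ultimately show ?thesis using a by blast
  qed
qed

lemma ray_decomposition_exists:
  assumes pos: "0 < d * n" and closed: "\<And>b. b \<in> \<Delta> \<Longrightarrow> b + d * n \<in> \<Delta>"
  defines "A \<equiv> {a \<in> \<Delta>. \<forall>b\<in>\<Delta>. a \<noteq> b + d * n}"
  shows "\<Delta> = (\<Union>a\<in>A. ray d n a)" "disjoint_family_on (ray d n) A"
proof -
  have up: "b + d * n * k \<in> \<Delta>" if "b \<in> \<Delta>" for b k
  proof (induction k)
    case (Suc k)
    from closed[OF Suc] show ?case by (simp add: algebra_simps)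
  qed (use that in simp)
  have down: "\<exists>a\<in>A. b \<in> ray d n a" if "b \<in> \<Delta>" for b
    using that
  proof (induction b rule: less_induct)
    case (less b)
    show ?case
    proof (cases "b \<in> A")
      case True
      then show ?thesis by (force simp: ray_def)
    next
      case False
      with less obtain b' where b': "b' \<in> \<Delta>" "b = b' + d * n" by (auto simp: A_def)
      with pos have "b' < b" by linarith
      from less.IH[OF this b'(1)] obtain a k where "a \<in> A" "b' = a + d * n * k"
        by (auto simp: ray_def)
      then have "a \<in> A" "b = a + d * n * Suc k" using b' by simp_all
      then show ?thesis unfolding ray_def by blast
    qed
  qed
  show "\<Delta> = (\<Union>a\<in>A. ray d n a)"
  proof (intro equalityI subsetI)
    fix b assume "b \<in> (\<Union>a\<in>A. ray d n a)"
    then show "b \<in> \<Delta>" using up by (auto simp: ray_def A_def)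
  qed (use down in blast)
  have key: "a = a'" if "a \<in> A" "a' \<in> A" "a + d * n * k = a' + d * n * l" "k \<le> l" for a a' k l
  proof -
    from that(4) have "a = a' + d * n * (l - k)"
      using that(3) by (auto simp: le_iff_add algebra_simps)
    then show ?thesis
    proof (cases "l - k")
      case (Suc q)
      have "a' + d * n * q \<in> \<Delta>" using that(2) up by (auto simp: A_def)
      moreover have "a = (a' + d * n * q) + d * n" using \<open>a = _\<close> Suc by simp
      ultimately show ?thesis using that(1) by (auto simp: A_def)
    qed simp
  qed
  show "disjoint_family_on (ray d n) A"
    unfolding disjoint_family_on_def
  proof (intro ballI impI)
    fix a a' assume "a \<in> A" "a' \<in> A" "a \<noteq> a'"
    then show "ray d n a \<inter> ray d n a' = {}"
      using key[of a a'] key[of a' a] by (auto simp: ray_def) (metis nat_le_linear)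
  qed
qed

lemma gens_eq:
  assumes "0 < d * n" and "\<And>b. b \<in> \<Delta> \<Longrightarrow> b + d * n \<in> \<Delta>"
  shows "gens d n \<Delta> = {a \<in> \<Delta>. \<forall>b\<in>\<Delta>. a \<noteq> b + d * n}"
  unfolding gens_def
proof (rule the_equality)
  show "\<Delta> = (\<Union>a\<in>{a \<in> \<Delta>. \<forall>b\<in>\<Delta>. a \<noteq> b + d * n}. ray d n a) \<and>
      disjoint_family_on (ray d n) {a \<in> \<Delta>. \<forall>b\<in>\<Delta>. a \<noteq> b + d * n}"
    using ray_decomposition_exists[of d n \<Delta>] assms by blast
qed (use ray_decomposition_eq[OF assms(1)] in blast)

end

theory Submission
  imports Defs
begin

text \<open>
  Pass from a family \<open>y\<close> to its ranks \<open>m * x - n * y x\<close>. In these terms \<open>Yset\<close> consists of paths of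
  length \<open>d * n\<close>: they start at \<open>0\<close>, stay nonnegative, and rise by at most \<open>m\<close> per step. An admissible
  set becomes \<open>d\<close> nonnegative rows of length \<open>n\<close>, the first of which starts with \<open>0\<close>. Each row is cyclic
  in the sense that it rises by at most \<open>m\<close> from each entry to the next one, the last being followed
  by the first. This is closure under \<open>d * m\<close>. The admissibility condition for \<open>i\<close> says that rows \<open>i\<close>
  and \<open>i + 1\<close> are linked: some entry of row \<open>i + 1\<close> exceeds the preceding entry of row \<open>i\<close> by at most
  \<open>m\<close>. Closure under \<open>d * m * n + 1\<close> then comes for free (\<open>linked_rows_vertical\<close>), as does the
  admissibility condition for \<open>d - 1\<close>.

  Step \<open>u\<close> of \<open>Psi\<close> cuts out of a path of length \<open>(u + 1) * n\<close> its last window of \<open>n\<close> consecutive entries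
  that is cyclic, and declares it to be row \<open>u\<close>; step \<open>u\<close> of \<open>Phi\<close> inserts row \<open>u\<close> into a path of length
  \<open>u * n\<close> at the last place where it fits. So both procedures pass through the intermediate states
  \<open>assembled d n m u\<close>, in which the first \<open>u + 1\<close> rows are merged into a path and the others are still
  separate. The heart of the matter is that the two steps are inverse to each other.

  If a window is cut out at \<open>p\<close>, then maximality of \<open>p\<close> forces the path to drop steeply after \<open>p\<close>: each
  later entry exceeds the entry \<open>n - 1\<close> places further on by more than \<open>m\<close>, hence also the one \<open>n\<close> places
  further on (\<open>tail_descent\<close>, \<open>tail_period_descent\<close>). So the row is too high to fit at any later
  place, and \<open>p\<close> is recovered (\<open>extract_row\<close>). Conversely, the row inserted at \<open>p\<close> is a cyclic window; a
  later window is not cyclic, either because the row did not fit there, or because it lies in the steep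
  tail left behind by the previous step. The second case uses that the positions increase strictly
  with \<open>u\<close>, and this is what the link between consecutive rows guarantees (\<open>assembled_pt_step\<close>,
  \<open>insert_row\<close>).

  Hence \<open>Psi\<close> and \<open>Phi\<close> run through one and the same \<open>chain\<close> of states in opposite directions, with the
  same positions and so the same cycles. The composed permutations say which entry of the original family
  ends up where, and rewriting this from ranks to coordinates gives the formulas that define
  \<open>Psi_coord\<close> and \<open>Phi\<close>.
\<close>

section \<open>The positions at which rows are extracted and inserted\<close>

text \<open>
  The index within a row is read modulo \<open>n\<close>, so that a row is a periodic sequence and the convention
  about index \<open>(u, n)\<close> becomes automatic.
\<close>

definition row :: "nat \<Rightarrow> (nat \<Rightarrow> int) \<Rightarrow> nat \<Rightarrow> nat \<Rightarrow> int" where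
  "row n q i x = q (i * n + x mod n)"

lemma row_add_period [simp]: "row n q i (x + n) = row n q i x"
  by (simp add: row_def)

text \<open>
  The position \<open>0\<close> is always a candidate for families of interest, since their ranks are nonnegative
  and start at \<open>0\<close>.
\<close>

lemma p_step_bounds:
  assumes "r 0 \<le> r (n - 1) + int m"
  shows "p_step n m u r \<le> u * n" "r (p_step n m u r) \<le> r (p_step n m u r + n - 1) + int m"
proof -
  let ?S = "{x. x \<le> u * n \<and> r x \<le> r (x + n - 1) + int m}"
  have "finite ?S" by (rule finite_subset[of _ "{..u * n}"]) auto
  moreover have "0 \<in> ?S" using assms by simp
  ultimately have "Max ?S \<in> ?S" by (intro Max_in) auto
  then show "p_step n m u r \<le> u * n" "r (p_step n m u r) \<le> r (p_step n m u r + n - 1) + int m"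
    by (simp_all add: p_step_def)
qed

lemma p_step_ge:
  assumes "x \<le> u * n" "r x \<le> r (x + n - 1) + int m"
  shows "x \<le> p_step n m u r"
  unfolding p_step_def
  by (rule Max_ge) (use assms in \<open>auto intro: finite_subset[of _ "{..u * n}"]\<close>)

lemma p_step_eqI:
  assumes "p \<le> u * n" "r p \<le> r (p + n - 1) + int m"
    and "\<And>x. p < x \<Longrightarrow> x \<le> u * n \<Longrightarrow> r (x + n - 1) + int m < r x"
  shows "p_step n m u r = p"
  unfolding p_step_def
proof (rule Max_eqI)
  show "finite {x. x \<le> u * n \<and> r x \<le> r (x + n - 1) + int m}"
    by (rule finite_subset[of _ "{..u * n}"]) auto
  show "x \<le> p" if "x \<in> {x. x \<le> u * n \<and> r x \<le> r (x + n - 1) + int m}" for x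
    using that assms(3)[of x] by force
qed (use assms in auto)

text \<open>
  Indexing by the insertion position \<open>x = i * n + j + 1\<close> instead of the entry before it: a row can be
  inserted at \<open>x\<close> if its entry of residue \<open>x\<close> is at most \<open>m\<close> above its new predecessor.
\<close>

lemma pt_step_alt:
  assumes "0 < n"
  shows "pt_step n m u r = Max {x. 1 \<le> x \<and> x \<le> u * n \<and> row n r u x \<le> r (x - 1) + int m}"
proof -
  have "{i * n + j + 1 | i j. i < u \<and> j < n \<and>
     (if j + 1 = n then r (u * n) else r (u * n + (j + 1))) \<le> r (i * n + j) + int m}
    = {x. 1 \<le> x \<and> x \<le> u * n \<and> row n r u x \<le> r (x - 1) + int m}" (is "?L = ?R")
  proof (intro equalityI subsetI)
    fix x assume "x \<in> ?L"
    then obtain i j where ij: "x = i * n + j + 1" "i < u" "j < n"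
      "(if j + 1 = n then r (u * n) else r (u * n + (j + 1))) \<le> r (i * n + j) + int m" by blast
    have "x mod n = (if j + 1 = n then 0 else j + 1)"
      using ij(1,3) mod_mult_self3[of i n "j + 1"] by (auto simp: add.assoc)
    moreover have "x \<le> u * n"
    proof -
      have "(i + 1) * n \<le> u * n" using ij(2) by (intro mult_right_mono) auto
      then show ?thesis using ij by simp
    qed
    ultimately show "x \<in> ?R" using ij by (auto simp: row_def split: if_splits)
  next
    fix x assume x: "x \<in> ?R"
    define i j where "i = (x - 1) div n" and "j = (x - 1) mod n"
    have ij: "x = i * n + j + 1" "j < n" using x assms by (auto simp: i_def j_def)
    have "i < u" using x by (auto simp: i_def less_mult_imp_div_less)
    moreover have "x mod n = (if j + 1 = n then 0 else j + 1)"
      using ij mod_mult_self3[of i n "j + 1"] by (auto simp: add.assoc)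
    then have "(if j + 1 = n then r (u * n) else r (u * n + (j + 1))) \<le> r (i * n + j) + int m"
      using x ij by (auto simp: row_def)
    ultimately show "x \<in> ?L" using ij by blast
  qed
  then show ?thesis by (simp add: pt_step_def)
qed

lemma pt_step_bounds:
  assumes "0 < n" "1 \<le> x" "x \<le> u * n" "row n r u x \<le> r (x - 1) + int m"
  shows "x \<le> pt_step n m u r" "pt_step n m u r \<le> u * n"
    "row n r u (pt_step n m u r) \<le> r (pt_step n m u r - 1) + int m"
proof -
  let ?S = "{x. 1 \<le> x \<and> x \<le> u * n \<and> row n r u x \<le> r (x - 1) + int m}"
  have fin: "finite ?S" by (rule finite_subset[of _ "{..u * n}"]) auto
  have x: "x \<in> ?S" using assms by simp
  then have "Max ?S \<in> ?S" using fin by (intro Max_in) auto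
  moreover have "x \<le> Max ?S" using fin x by simp
  ultimately show "x \<le> pt_step n m u r" "pt_step n m u r \<le> u * n"
    "row n r u (pt_step n m u r) \<le> r (pt_step n m u r - 1) + int m"
    unfolding pt_step_alt[OF assms(1)] by blast+
qed

lemma pt_step_eqI:
  assumes "0 < n" "1 \<le> p" "p \<le> u * n" "row n r u p \<le> r (p - 1) + int m"
    and "\<And>x. p < x \<Longrightarrow> x \<le> u * n \<Longrightarrow> r (x - 1) + int m < row n r u x"
  shows "pt_step n m u r = p"
proof -
  note b = pt_step_bounds[OF assms(1-4)]
  have "\<not> p < pt_step n m u r" using assms(5)[of "pt_step n m u r"] b by linarith
  then show ?thesis using b(1) by linarith
qed

section \<open>Moving one row out of or into a path\<close>

text \<open>
  Permutes the positions, acting on each residue class modulo \<open>n\<close> by a permutation of the row indices.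
\<close>

definition lift :: "nat \<Rightarrow> (nat \<Rightarrow> nat \<Rightarrow> nat) \<Rightarrow> nat \<Rightarrow> nat" where
  "lift n s x = s (x mod n) (x div n) * n + x mod n"

lemma lift_mod [simp]: "lift n s x mod n = x mod n"
  by (simp add: lift_def)

lemma lift_div [simp]: "0 < n \<Longrightarrow> lift n s x div n = s (x mod n) (x div n)"
  by (simp add: lift_def)

lemma lift_comp: "0 < n \<Longrightarrow> lift n (\<lambda>j. s j \<circ> t j) = lift n s \<circ> lift n t"
  by (rule ext) (simp add: lift_def)

lemma lift_id [simp]: "lift n (\<lambda>j. id) = id"
  by (rule ext) (simp add: lift_def)

lemma bij_lift:
  assumes "0 < n" "\<And>j. j < n \<Longrightarrow> bij (s j)"
  shows "bij (lift n s)" "inv (lift n s) = lift n (\<lambda>j. inv (s j))"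
proof -
  have s: "s (x mod n) (inv (s (x mod n)) i) = i" "inv (s (x mod n)) (s (x mod n) i) = i" for x i
    using assms(2)[of "x mod n"] assms(1) by (simp_all add: bij_is_surj surj_f_inv_f bij_is_inj)
  have "lift n (\<lambda>j. inv (s j)) (lift n s x) = x" "lift n s (lift n (\<lambda>j. inv (s j)) x) = x" for x
    unfolding lift_def[of n _ "lift n _ x"] using assms(1) by (simp_all add: s)
  then have "lift n (\<lambda>j. inv (s j)) \<circ> lift n s = id" "lift n s \<circ> lift n (\<lambda>j. inv (s j)) = id"
    by (auto simp: fun_eq_iff)
  then show "bij (lift n s)" "inv (lift n s) = lift n (\<lambda>j. inv (s j))"
    using o_bij inv_unique_comp by blast+
qed

lemma bij_cyc: "a \<le> u \<Longrightarrow> bij (cyc a u)"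
  by (rule bij_betw_byWitness[where f' = "\<lambda>i. if i = a then u else if a < i \<and> i \<le> u then i - 1 else i"])
     (auto simp: cyc_def)

lemma idx_le_iff:
  assumes "p \<le> u * n" "i \<le> u"
  shows "idx n p j u \<le> i \<longleftrightarrow> p \<le> i * n + j"
proof -
  let ?S = "{i. i \<le> u \<and> p \<le> i * n + j}"
  have fin: "finite ?S" by simp
  have "u \<in> ?S" using assms by simp
  then have mem: "Min ?S \<in> ?S" using fin by (intro Min_in) auto
  show ?thesis
  proof
    assume "idx n p j u \<le> i"
    then have "Min ?S * n \<le> i * n" by (intro mult_right_mono) (simp_all add: idx_def)
    moreover have "p \<le> Min ?S * n + j" using mem by blast
    ultimately show "p \<le> i * n + j" by linarith
  next
    assume "p \<le> i * n + j"
    then show "idx n p j u \<le> i" unfolding idx_def by (intro Min_le fin) (simp add: assms)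
  qed
qed

lemma idx_le: "p \<le> u * n \<Longrightarrow> idx n p j u \<le> u"
  by (simp add: idx_le_iff)

text \<open>
  The window \<open>[p, p + n)\<close> contains one position of each residue \<open>j\<close>, and \<open>idx\<close> is the row index of
  that position.
\<close>

lemma idx_window:
  assumes "p \<le> u * n" "p \<le> x" "x < p + n"
  shows "idx n p (x mod n) u * n + x mod n = x"
proof -
  have n: "0 < n" using assms by linarith
  have x: "x = x div n * n + x mod n" by simp
  have "x < Suc u * n" using assms by simp
  then have "x div n < Suc u" by (rule less_mult_imp_div_less)
  then have xu: "x div n \<le> u" by simp
  have le: "idx n p (x mod n) u \<le> x div n" using idx_le_iff[OF assms(1) xu, of "x mod n"] assms x by simp
  have "\<not> idx n p (x mod n) u < x div n"
  proof
    assume lt: "idx n p (x mod n) u < x div n"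
    then have "idx n p (x mod n) u \<le> x div n - 1" by simp
    then have "p \<le> (x div n - 1) * n + x mod n"
      using idx_le_iff[OF assms(1), of "x div n - 1" "x mod n"] xu by simp
    moreover have "x = (x div n - 1) * n + x mod n + n"
      using lt x by (cases "x div n") (auto simp: algebra_simps)
    ultimately show False using assms(3) by linarith
  qed
  then show ?thesis using le x by simp
qed

text \<open>
  If \<open>q\<close> is a path of length \<open>(u + 1) * n\<close>, then \<open>q \<circ> transfer n p u\<close> has the window \<open>[p, p + n)\<close> of \<open>q\<close>
  as row \<open>u\<close>, and before it the path that remains when the gap is closed. Expressing this by the cycles
  \<open>cyc (idx n p j u) u\<close> is what ties the procedures to the permutations in the definitions of
  \<open>Psi\<close> and \<open>Phi\<close>.
\<close>

definition transfer :: "nat \<Rightarrow> nat \<Rightarrow> nat \<Rightarrow> nat \<Rightarrow> nat" where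
  "transfer n p u = lift n (\<lambda>j. cyc (idx n p j u) u)"

context
  fixes n p u :: nat
  assumes n: "0 < n" and p: "p \<le> u * n"
begin

lemma bij_transfer: "bij (transfer n p u)"
  unfolding transfer_def by (rule bij_lift(1)[OF n]) (simp add: bij_cyc idx_le p)

lemma transfer_below: "x < p \<Longrightarrow> transfer n p u x = x"
proof -
  assume x: "x < p"
  then have xu: "x div n < u" using p by (intro less_mult_imp_div_less) linarith
  then have "\<not> idx n p (x mod n) u \<le> x div n"
    using idx_le_iff[OF p, of "x div n" "x mod n"] x by simp
  then show ?thesis using xu by (simp add: transfer_def lift_def cyc_def)
qed

lemma transfer_shift: "p \<le> x \<Longrightarrow> x < u * n \<Longrightarrow> transfer n p u x = x + n"
proof -
  assume x: "p \<le> x" "x < u * n"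
  then have xu: "x div n < u" by (intro less_mult_imp_div_less)
  then have "idx n p (x mod n) u \<le> x div n"
    using idx_le_iff[OF p, of "x div n" "x mod n"] x by simp
  then show ?thesis using xu by (simp add: transfer_def lift_def cyc_def)
qed

lemma transfer_window: "p \<le> x \<Longrightarrow> x < p + n \<Longrightarrow> transfer n p u (u * n + x mod n) = x"
  using idx_window[OF p, of x] n by (simp add: transfer_def lift_def cyc_def)

lemma transfer_above: "Suc u * n \<le> x \<Longrightarrow> transfer n p u x = x"
proof -
  assume x: "Suc u * n \<le> x"
  then have "Suc u \<le> x div n" using n by (simp add: less_eq_div_iff_mult_less_eq)
  then show ?thesis by (simp add: transfer_def lift_def cyc_def)
qed

lemma transfer_less_iff:
  assumes "Suc u * n \<le> N"
  shows "transfer n p u x < N \<longleftrightarrow> x < N"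
proof
  have ge: "transfer n p u x = x" if "N \<le> x" for x
    using transfer_above[of x] that assms by linarith
  show "x < N" if "transfer n p u x < N" using ge[of x] that by (cases "N \<le> x") auto
  show "transfer n p u x < N" if "x < N"
  proof (rule ccontr)
    assume "\<not> transfer n p u x < N"
    then have "transfer n p u (transfer n p u x) = transfer n p u x" by (intro ge) simp
    then have "transfer n p u x = x" using bij_transfer by (simp add: bij_def inj_eq)
    then show False using \<open>\<not> _\<close> that by simp
  qed
qed

end

section \<open>Partially assembled families\<close>

text \<open>
  The state in which rows \<open>0, \<dots>, u\<close> are merged into a path on \<open>{..<(u + 1) * n}\<close>. The other rows are
  cyclic and linked to each other. Row \<open>u + 1\<close> is linked to the window that is about to be cut out
  of the path, as that window takes the place of row \<open>u\<close>.
\<close>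

definition assembled :: "nat \<Rightarrow> nat \<Rightarrow> nat \<Rightarrow> nat \<Rightarrow> (nat \<Rightarrow> int) \<Rightarrow> bool" where
  "assembled d n m u q \<longleftrightarrow>
     q 0 = 0 \<and> (\<forall>x<d * n. 0 \<le> q x) \<and>
     (\<forall>x. Suc x < Suc u * n \<longrightarrow> q (Suc x) \<le> q x + int m) \<and>
     (\<forall>i x. u < i \<longrightarrow> i < d \<longrightarrow> row n q i (Suc x) \<le> row n q i x + int m) \<and>
     (\<forall>i. u < i \<longrightarrow> Suc i < d \<longrightarrow> (\<exists>x. row n q (Suc i) (Suc x) \<le> row n q i x + int m)) \<and>
     (Suc u < d \<longrightarrow> (\<exists>x. p_step n m u q \<le> x \<and> x < p_step n m u q + n \<and>
        row n q (Suc u) (Suc x) \<le> q x + int m))"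

lemma window_representative:
  fixes n p x :: nat
  assumes "0 < n"
  obtains y where "p \<le> y" "y < p + n" "y mod n = x mod n"
proof
  show "p \<le> p + (x + (n - 1) * p) mod n" by simp
  show "p + (x + (n - 1) * p) mod n < p + n" using assms by simp
  have "p + (x + (n - 1) * p) = x + n * p" using assms by (cases n) auto
  then have "(p + (x + (n - 1) * p) mod n) mod n = (x + n * p) mod n" by (simp only: mod_add_right_eq)
  then show "(p + (x + (n - 1) * p) mod n) mod n = x mod n" by simp
qed

lemma tail_descent:
  assumes "p_step n m u q < x" "x \<le> u * n"
  shows "q (x + n - 1) + int m < q x"
  using p_step_ge[of x u n q m] assms by force

text \<open>
  The path rises by at most \<open>m\<close> from \<open>x\<close> to \<open>x + 1\<close>, and drops by more than \<open>m\<close> from there to \<open>x + n\<close>.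
  Using the drop at \<open>x + 1\<close> rather than at \<open>x\<close> is what includes \<open>x = p_step n m u q\<close>, where there is no drop.
\<close>

lemma tail_period_descent:
  assumes n: "0 < n" and path: "\<And>x. Suc x < Suc u * n \<Longrightarrow> q (Suc x) \<le> q x + int m"
    and "p_step n m u q \<le> x" "x + n < Suc u * n"
  shows "q (x + n) < q x"
proof -
  have "q (Suc x + n - 1) + int m < q (Suc x)"
    by (rule tail_descent[where u = u]) (use assms in auto)
  moreover have "q (Suc x) \<le> q x + int m" by (rule path) (use assms in auto)
  ultimately show ?thesis by simp
qed

lemma tail_period_le:
  assumes n: "0 < n" and path: "\<And>x. Suc x < Suc u * n \<Longrightarrow> q (Suc x) \<le> q x + int m"
    and "p_step n m u q \<le> w" "w \<le> x" "x < Suc u * n" "x mod n = w mod n"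
  shows "q x \<le> q w"
proof -
  obtain k where x: "x = w + k * n"
    using assms(4,6) by (metis mod_eq_dvd_iff_nat dvd_def le_add_diff_inverse mult.commute)
  have "w + k * n < Suc u * n \<Longrightarrow> q (w + k * n) \<le> q w" for k
  proof (induction k)
    case (Suc k)
    have "q (w + k * n + n) < q (w + k * n)"
      by (rule tail_period_descent[of n u]) (use assms Suc.prems in auto)
    then show ?case using Suc by (simp add: algebra_simps)
  qed simp
  then show ?thesis using assms x by simp
qed

section \<open>Extraction and insertion are mutually inverse\<close>

lemma comp_transfer:
  assumes "0 < n" "p \<le> u * n"
  shows "x < p \<Longrightarrow> (q \<circ> transfer n p u) x = q x"
    and "p \<le> x \<Longrightarrow> x < u * n \<Longrightarrow> (q \<circ> transfer n p u) x = q (x + n)"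
    and "p \<le> x \<Longrightarrow> x < p + n \<Longrightarrow> row n (q \<circ> transfer n p u) u x = q x"
    and "u < i \<Longrightarrow> row n (q \<circ> transfer n p u) i x = row n q i x"
proof -
  show "u < i \<Longrightarrow> row n (q \<circ> transfer n p u) i x = row n q i x"
  proof -
    assume "u < i"
    then have "Suc u * n \<le> i * n" by (intro mult_right_mono) auto
    then have "Suc u * n \<le> i * n + x mod n" by linarith
    from transfer_above[OF assms this] show ?thesis by (simp add: row_def)
  qed
qed (simp_all add: transfer_below transfer_shift transfer_window row_def assms)

lemma assembledD:
  assumes "assembled d n m u q"
  shows "q 0 = 0" "\<And>x. x < d * n \<Longrightarrow> 0 \<le> q x"
    "\<And>x. Suc x < Suc u * n \<Longrightarrow> q (Suc x) \<le> q x + int m"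
    "\<And>i x. u < i \<Longrightarrow> i < d \<Longrightarrow> row n q i (Suc x) \<le> row n q i x + int m"
    "\<And>i. u < i \<Longrightarrow> Suc i < d \<Longrightarrow> \<exists>x. row n q (Suc i) (Suc x) \<le> row n q i x + int m"
    "Suc u < d \<Longrightarrow> \<exists>x. p_step n m u q \<le> x \<and> x < p_step n m u q + n \<and>
        row n q (Suc u) (Suc x) \<le> q x + int m"
  using assms unfolding assembled_def by blast+

text \<open>
  The position \<open>1\<close> is a candidate since the entry there is at most \<open>m\<close>, while all entries are
  nonnegative. So the entry \<open>0\<close> at the start is never cut out, except as part of the last remaining row.
\<close>

lemma assembled_p_step:
  assumes n: "0 < n" and u: "u < d" and a: "assembled d n m u q"
  shows "p_step n m u q \<le> u * n" "q (p_step n m u q) \<le> q (p_step n m u q + n - 1) + int m"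
    "0 < u \<Longrightarrow> 1 \<le> p_step n m u q"
proof -
  note A = assembledD[OF a]
  have un: "Suc u * n \<le> d * n" using u by (intro mult_right_mono) auto
  have "n - 1 < n" "n \<le> Suc u * n" using n by simp_all
  then have "n - 1 < d * n" using un by linarith
  then have "q 0 \<le> q (n - 1) + int m" using A(1) A(2) by fastforce
  from p_step_bounds[OF this]
  show "p_step n m u q \<le> u * n" "q (p_step n m u q) \<le> q (p_step n m u q + n - 1) + int m" .
  assume "0 < u"
  then have un1: "1 * 1 \<le> u * n" using n by (intro mult_mono) auto
  have n1: "Suc 0 < Suc u * n" using un1 n by (simp only: mult_Suc)
  have nd: "n < d * n" using u \<open>0 < u\<close> n by simp
  have "q 1 \<le> q n + int m"
    using A(1) A(2)[OF nd] A(3)[OF n1] by simp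
  then show "1 \<le> p_step n m u q" by (intro p_step_ge) (use un1 in auto)
qed

text \<open>
  Within the window the path property applies, and the choice of the position provides the step from
  the end of the window back to its start.
\<close>

lemma window_cyclic:
  assumes n: "0 < n" and u: "u < d" and a: "assembled d n m u q"
    and w: "\<And>x. p_step n m u q \<le> x \<Longrightarrow> x < p_step n m u q + n \<Longrightarrow> row n q' i x = q x"
  shows "row n q' i (Suc x) \<le> row n q' i x + int m"
proof -
  let ?p = "p_step n m u q"
  note P = assembled_p_step[OF n u a] and A = assembledD[OF a]
  obtain y where y: "?p \<le> y" "y < ?p + n" "y mod n = x mod n"
    using window_representative[OF n] .
  have rx: "row n q' i x = q y" using w[OF y(1,2)] y(3) by (simp add: row_def)
  have sx: "Suc x mod n = Suc y mod n" using y(3) by (metis mod_Suc_eq)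
  show ?thesis
  proof (cases "Suc y < ?p + n")
    case True
    then have "row n q' i (Suc x) = q (Suc y)"
      using w[of "Suc y"] y sx by (simp add: row_def)
    moreover have "q (Suc y) \<le> q y + int m" by (rule A(3)) (use True P in auto)
    ultimately show ?thesis using rx by simp
  next
    case False
    then have yp: "Suc y = ?p + n" using y by simp
    then have "row n q' i (Suc x) = q ?p"
      using w[of ?p] n sx by (simp add: row_def)
    moreover have "y = ?p + n - 1" using yp by simp
    ultimately show ?thesis using rx P(2) by simp
  qed
qed

text \<open>
  One step of \<open>Psi\<close>. It can be undone because, beyond \<open>p\<close>, the entries of the extracted row dominate
  those of the same residue in the path, and these drop by more than \<open>m\<close> over the next \<open>n - 1\<close> places.
\<close>

lemma extract_row:
  assumes n: "0 < n" and v: "Suc v < d" and a: "assembled d n m (Suc v) q"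
  defines "p \<equiv> p_step n m (Suc v) q"
  defines "q' \<equiv> q \<circ> transfer n p (Suc v)"
  shows "assembled d n m v q'" "pt_step n m (Suc v) q' = p"
proof -
  note A = assembledD[OF a]
  note P = assembled_p_step[OF n v a, folded p_def]
  have p1: "1 \<le> p" using P(3) by simp
  note T = comp_transfer[OF n P(1), of _ q, folded q'_def]
  have un: "Suc (Suc v) * n \<le> d * n" using v by (intro mult_right_mono) auto
  have descent: "q (x + n - 1) + int m < q x" if "p < x" "x \<le> Suc v * n" for x
    by (rule tail_descent[where u = "Suc v"]) (use that in \<open>auto simp: p_def\<close>)
  have path': "q' (Suc x) \<le> q' x + int m" if x: "Suc x < Suc v * n" for x
  proof -
    \<comment> \<open>Only the seam at \<open>p\<close>, where the two ends of the gap now meet, is not inherited from \<open>q\<close>.\<close>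
    consider "Suc x < p" | "Suc x = p" | "p \<le> x" by linarith
    then show ?thesis
    proof cases
      case 1
      then show ?thesis using A(3)[of x] T(1)[of x] T(1)[of "Suc x"] x by simp
    next
      case 2
      have "q (p + n) + int m < q (Suc p)" using descent[of "Suc p"] 2 x n by simp
      moreover have "q (Suc p) \<le> q p + int m" using A(3)[of p] 2 x n by simp
      moreover have "q p \<le> q x + int m" using A(3)[of x] 2 x by simp
      ultimately have "q (p + n) \<le> q x + int m" by simp
      then show ?thesis using T(1)[of x] T(2)[of p] 2 x by simp
    next
      case 3
      then show ?thesis using A(3)[of "x + n"] T(2)[of x] T(2)[of "Suc x"] x by simp
    qed
  qed
  have zero': "q' 0 = 0" using T(1)[of 0] p1 A(1) by simp
  have nonneg': "0 \<le> q' x" if "x < d * n" for x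
    using A(2)[of "transfer n p (Suc v) x"] transfer_less_iff[OF n P(1) un, of x] that
    by (simp add: q'_def)
  have descent': "q' (x + n - 1) + int m < q' x" if "p \<le> x" "x \<le> v * n" for x
  proof -
    have "q' (x + n - 1) = q (x + n + n - 1)" using T(2)[of "x + n - 1"] that n by simp
    moreover have "q' x = q (x + n)" using T(2)[of x] that n by simp
    ultimately show ?thesis using descent[of "x + n"] that n by simp
  qed
  let ?p' = "p_step n m v q'"
  have "q' 0 \<le> q' (n - 1) + int m" using zero' nonneg'[of "n - 1"] un n by force
  note P' = p_step_bounds[OF this, of v]
  have p': "?p' < p" using descent'[of ?p'] P' by force
  \<comment> \<open>The link to the next window: the entry before \<open>p\<close> either lies in that window or is dominated by
    the window entry of the same residue.\<close>
  have link': "\<exists>x. ?p' \<le> x \<and> x < ?p' + n \<and> row n q' (Suc v) (Suc x) \<le> q' x + int m"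
  proof -
    obtain y where y: "?p' \<le> y" "y < ?p' + n" "y mod n = (p - 1) mod n"
      using window_representative[OF n] .
    have "q' (p - 1) \<le> q' y"
    proof (cases "p \<le> ?p' + n")
      case True
      have "p - 1 = y"
      proof -
        have b: "?p' \<le> p - 1" "p - 1 < ?p' + n" using True p' by simp_all
        have "\<not> y < p - 1"
        proof
          assume "y < p - 1"
          moreover have "n dvd p - 1 - y" using y(3) calculation by (metis less_imp_le mod_eq_dvd_iff_nat)
          ultimately have "n \<le> p - 1 - y" by (intro dvd_imp_le) auto
          then show False using b y by linarith
        qed
        moreover have "\<not> p - 1 < y"
        proof
          assume "p - 1 < y"
          moreover have "n dvd y - (p - 1)" using y(3) calculation by (metis less_imp_le mod_eq_dvd_iff_nat)
          ultimately have "n \<le> y - (p - 1)" by (intro dvd_imp_le) auto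
          then show False using b y by linarith
        qed
        ultimately show ?thesis by simp
      qed
      then show ?thesis by simp
    next
      case False
      show ?thesis
        by (rule tail_period_le[where u = v and q = q', OF n path']) (use False y P(1) p1 in auto)
    qed
    moreover have "q' (p - 1) = q (p - 1)" using T(1)[of "p - 1"] p1 by simp
    moreover have "row n q' (Suc v) (Suc y) = q p"
    proof -
      have "Suc y mod n = p mod n" using y(3) p1 by (metis mod_Suc_eq Suc_pred' One_nat_def Suc_le_lessD)
      then show ?thesis using T(3)[of p] n by (simp add: row_def)
    qed
    moreover have "q p \<le> q (p - 1) + int m" using A(3)[of "p - 1"] p1 P(1) n by simp
    ultimately show ?thesis using y by force
  qed
  have cyc': "row n q' i (Suc x) \<le> row n q' i x + int m" if "v < i" "i < d" for i x
  proof (cases "i = Suc v")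
    case True
    show ?thesis unfolding True
      by (rule window_cyclic[OF n v a]) (use T(3) in \<open>simp add: p_def\<close>)
  next
    case False
    then show ?thesis using A(4)[of i x] T(4)[of i] that by simp
  qed
  have links': "\<exists>x. row n q' (Suc i) (Suc x) \<le> row n q' i x + int m" if i: "v < i" "Suc i < d" for i
  proof (cases "i = Suc v")
    case True
    then obtain x where "p \<le> x" "x < p + n" "row n q (Suc i) (Suc x) \<le> q x + int m"
      using A(6) i unfolding p_def by blast
    then show ?thesis using T(3)[of x] T(4)[of "Suc i" "Suc x"] True by (intro exI[of _ x]) simp
  next
    case False
    then show ?thesis using A(5)[of i] T(4) i by simp
  qed
  show "assembled d n m v q'"
    unfolding assembled_def using zero' nonneg' path' cyc' links' link' by blast
  show "pt_step n m (Suc v) q' = p"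
  proof (rule pt_step_eqI[OF n p1 P(1)])
    show "row n q' (Suc v) p \<le> q' (p - 1) + int m"
      using T(3)[of p] T(1)[of "p - 1"] A(3)[of "p - 1"] p1 P(1) n by simp
    fix x assume x: "p < x" "x \<le> Suc v * n"
    obtain y where y: "p \<le> y" "y < p + n" "y mod n = x mod n"
      using window_representative[OF n] .
    have "q x \<le> q y"
    proof (cases "y \<le> x")
      case True
      then show ?thesis
        by (intro tail_period_le[where u = "Suc v" and q = q, OF n A(3)]) (use x y n in \<open>auto simp: p_def\<close>)
    next
      case False
      then have "n dvd y - x" using y(3) by (metis nat_le_linear mod_eq_dvd_iff_nat)
      then have "n \<le> y - x" using False by (intro dvd_imp_le) auto
      then show ?thesis using x y by linarith
    qed
    moreover have "row n q' (Suc v) x = q y" using T(3)[of y] y by (simp add: row_def)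
    moreover have "q' (x - 1) = q (x + n - 1)" using T(2)[of "x - 1"] x by simp
    ultimately show "q' (x - 1) + int m < row n q' (Suc v) x" using descent[OF x] by simp
  qed
qed

text \<open>
  The link says that the new row fits right after some entry of the window at \<open>p_step n m v q'\<close>, hence
  strictly beyond the start of that window.
\<close>

lemma assembled_pt_step:
  assumes n: "0 < n" and v: "Suc v < d" and a: "assembled d n m v q'"
  shows "p_step n m v q' < pt_step n m (Suc v) q'" "pt_step n m (Suc v) q' \<le> Suc v * n"
    "row n q' (Suc v) (pt_step n m (Suc v) q') \<le> q' (pt_step n m (Suc v) q' - 1) + int m"
proof -
  let ?p' = "p_step n m v q'"
  obtain x where x: "?p' \<le> x" "x < ?p' + n" "row n q' (Suc v) (Suc x) \<le> q' x + int m"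
    using assembledD(6)[OF a v] by blast
  have "?p' \<le> v * n" using assembled_p_step(1)[OF n _ a] v by simp
  then have xn: "Suc x \<le> Suc v * n" using x by simp
  have "row n q' (Suc v) (Suc x) \<le> q' (Suc x - 1) + int m" using x(3) by simp
  note P = pt_step_bounds[OF n _ xn this]
  show "p_step n m v q' < pt_step n m (Suc v) q'" "pt_step n m (Suc v) q' \<le> Suc v * n"
    "row n q' (Suc v) (pt_step n m (Suc v) q') \<le> q' (pt_step n m (Suc v) q' - 1) + int m"
    using P x by simp_all
qed

text \<open>
  One step of \<open>Phi\<close>, described by the family \<open>q\<close> from which extraction at \<open>p\<close> would lead back to \<open>q'\<close>.
\<close>

lemma insert_row:
  assumes n: "0 < n" and v: "Suc v < d" and a: "assembled d n m v q'"
  defines "p \<equiv> pt_step n m (Suc v) q'"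
  assumes q': "q' = q \<circ> transfer n p (Suc v)"
  shows "assembled d n m (Suc v) q" "p_step n m (Suc v) q = p"
proof -
  note A = assembledD[OF a]
  note p' = assembled_pt_step(1)[OF n v a, folded p_def]
    and pn = assembled_pt_step(2)[OF n v a, folded p_def]
    and P3 = assembled_pt_step(3)[OF n v a, folded p_def]
  have p1: "1 \<le> p" using p' by simp
  note T = comp_transfer[OF n pn, of _ q, folded q']
  have un: "Suc (Suc v) * n \<le> d * n" using v by (intro mult_right_mono) auto
  have max: "q' (x - 1) + int m < row n q' (Suc v) x" if "p < x" "x \<le> Suc v * n" for x
    using pt_step_bounds(1)[OF n _ that(2), of q' m] that(1) by (force simp: p_def)
  have cyc': "row n q' (Suc v) (Suc x) \<le> row n q' (Suc v) x + int m" for x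
    using A(4) v by simp
  have path: "q (Suc x) \<le> q x + int m" if x: "Suc x < Suc (Suc v) * n" for x
  proof -
    consider "Suc x < p" | "Suc x = p" | "p \<le> x" "Suc x < p + n" | "Suc x = p + n" | "p + n \<le> x"
      by linarith
    then show ?thesis
    proof cases
      case 1
      then show ?thesis using A(3)[of x] T(1)[of x] T(1)[of "Suc x"] pn by simp
    next
      case 2
      then show ?thesis using P3 T(1)[of x] T(3)[of p] n by force
    next
      case 3
      then show ?thesis using T(3)[of x] T(3)[of "Suc x"] cyc'[of x] by simp
    next
      \<comment> \<open>The seam after the inserted row: it did not fit one place later, so its entries are high
        compared with what follows.\<close>
      case 4
      have "q' p + int m < row n q' (Suc v) (Suc p)" using max[of "Suc p"] 4 x by simp
      moreover have "row n q' (Suc v) (Suc p) \<le> row n q' (Suc v) p + int m" by (rule cyc')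
      moreover have "row n q' (Suc v) p \<le> row n q' (Suc v) x + int m"
        using cyc'[of x] 4 by simp
      moreover have "row n q' (Suc v) x = q x" using T(3)[of x] 4 n by simp
      moreover have "q' p = q (Suc x)" using T(2)[of p] 4 x by simp
      ultimately show ?thesis by simp
    next
      case 5
      then show ?thesis using A(3)[of "x - n"] T(2)[of "x - n"] T(2)[of "Suc x - n"] x
        by (simp add: Suc_diff_le)
    qed
  qed
  have zero: "q 0 = 0" using T(1)[of 0] p1 A(1) by simp
  have nonneg: "0 \<le> q x" if x: "x < d * n" for x
  proof -
    obtain y where y: "x = transfer n p (Suc v) y"
      using bij_transfer[OF n pn] by (metis bij_pointE)
    then have "y < d * n" using transfer_less_iff[OF n pn un, of y] x by simp
    then show ?thesis using A(2)[of y] y q' by simp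
  qed
  show pq: "p_step n m (Suc v) q = p"
  proof (rule p_step_eqI[OF pn])
    have "row n q' (Suc v) p \<le> row n q' (Suc v) (p + n - 1) + int m"
      using cyc'[of "p + n - 1"] n by simp
    then show "q p \<le> q (p + n - 1) + int m" using T(3)[of p] T(3)[of "p + n - 1"] n by simp
    fix x assume x: "p < x" "x \<le> Suc v * n"
    have prev: "q' (x - 1) = q (x + n - 1)" using T(2)[of "x - 1"] x by simp
    \<comment> \<open>Inside the inserted row the window at \<open>x\<close> is not cyclic because the row did not fit at \<open>x\<close>;
      beyond it, because \<open>x - n\<close> lies beyond the window of the previous step.\<close>
    show "q (x + n - 1) + int m < q x"
    proof (cases "x < p + n")
      case True
      then show ?thesis using max[OF x] prev T(3)[of x] x by simp
    next
      case False
      have "q' (x - n + n - 1) + int m < q' (x - n)"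
        by (rule tail_descent[where u = v]) (use False x p' in auto)
      moreover have "q' (x - n) = q x" using T(2)[of "x - n"] False x n by simp
      ultimately show ?thesis using prev False by simp
    qed
  qed
  have link: "\<exists>x. p \<le> x \<and> x < p + n \<and> row n q (Suc (Suc v)) (Suc x) \<le> q x + int m"
    if d2: "Suc (Suc v) < d"
  proof -
    obtain x where x: "row n q' (Suc (Suc v)) (Suc x) \<le> row n q' (Suc v) x + int m"
      using A(5)[OF lessI d2] by blast
    obtain y where y: "p \<le> y" "y < p + n" "y mod n = x mod n"
      using window_representative[OF n] .
    have "row n q' (Suc v) x = q y" using T(3)[OF y(1,2)] y(3) by (simp add: row_def)
    moreover have "Suc y mod n = Suc x mod n" using y(3) by (metis mod_Suc_eq)
    ultimately show ?thesis using x y T(4)[of "Suc (Suc v)" "Suc x"] by (auto simp: row_def)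
  qed
  have rows: "row n q i (Suc x) \<le> row n q i x + int m" if "Suc v < i" "i < d" for i x
    using A(4)[of i x] T(4)[of i] that by simp
  have links: "\<exists>x. row n q (Suc i) (Suc x) \<le> row n q i x + int m" if "Suc v < i" "Suc i < d" for i
    using A(5)[of i] T(4) that by simp
  show "assembled d n m (Suc v) q"
    unfolding assembled_def pq using zero nonneg path rows links link by blast
qed

section \<open>Chains of states\<close>

text \<open>
  A run of \<open>Psi\<close> read from \<open>d - 1\<close> down to \<open>0\<close>, or of \<open>Phi\<close> read upwards. The position at which row \<open>u + 1\<close> is
  moved is required to be the one that both procedures choose.
\<close>

definition chain :: "nat \<Rightarrow> nat \<Rightarrow> nat \<Rightarrow> (nat \<Rightarrow> nat \<Rightarrow> int) \<Rightarrow> bool" where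
  "chain d n m q \<longleftrightarrow> (\<forall>u<d. assembled d n m u (q u)) \<and>
     (\<forall>u. Suc u < d \<longrightarrow> pt_step n m (Suc u) (q u) = p_step n m (Suc u) (q (Suc u)) \<and>
        q u = q (Suc u) \<circ> transfer n (p_step n m (Suc u) (q (Suc u))) (Suc u))"

lemma chain_from_bottom:
  assumes n: "0 < n" and a: "assembled d n m 0 r"
  obtains q where "chain d n m q" "q 0 = r"
proof -
  define q where
    "q = rec_nat r (\<lambda>u f. f \<circ> inv (transfer n (pt_step n m (Suc u) f) (Suc u)))"
  have q0: "q 0 = r"
    and qS: "q (Suc u) = q u \<circ> inv (transfer n (pt_step n m (Suc u) (q u)) (Suc u))" for u
    by (simp_all add: q_def)
  have undo: "q u = q (Suc u) \<circ> transfer n (pt_step n m (Suc u) (q u)) (Suc u)"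
    if "Suc u < d" "assembled d n m u (q u)" for u
    using bij_transfer[OF n assembled_pt_step(2)[OF n that]]
    by (simp add: qS comp_assoc bij_is_inj)
  have asm: "assembled d n m u (q u)" if "u < d" for u
    using that
  proof (induction u)
    case (Suc u)
    then show ?case using insert_row(1)[OF n Suc.prems _ undo] by simp
  qed (simp add: q0 a)
  have "pt_step n m (Suc u) (q u) = p_step n m (Suc u) (q (Suc u)) \<and>
        q u = q (Suc u) \<circ> transfer n (p_step n m (Suc u) (q (Suc u))) (Suc u)" if "Suc u < d" for u
  proof -
    note a = asm[OF Suc_lessD[OF that]]
    show ?thesis using insert_row(2)[OF n that a undo[OF that a]] undo[OF that a] by simp
  qed
  then have "chain d n m q" using asm unfolding chain_def by blast
  then show thesis using that q0 by blast
qed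

text \<open>
  The states are produced from \<open>d - 1\<close> downwards, so the recursion runs over \<open>k = d - 1 - u\<close>.
\<close>

lemma chain_from_top:
  assumes n: "0 < n" and d: "0 < d" and a: "assembled d n m (d - 1) r"
  obtains q where "chain d n m q" "q (d - 1) = r"
proof -
  define g where
    "g = rec_nat r (\<lambda>k f. f \<circ> transfer n (p_step n m (d - Suc k) f) (d - Suc k))"
  define q where "q u = g (d - Suc u)" for u
  have top: "q (d - 1) = r" using d by (simp add: q_def g_def)
  have qS: "q u = q (Suc u) \<circ> transfer n (p_step n m (Suc u) (q (Suc u))) (Suc u)"
    if "Suc u < d" for u
  proof -
    have "d - Suc u = Suc (d - Suc (Suc u))" using that by simp
    moreover have "d - Suc (d - Suc (Suc u)) = Suc u" using that by simp
    ultimately show ?thesis by (simp add: q_def g_def)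
  qed
  have asm: "assembled d n m u (q u)" if "u < d" for u
  proof -
    from that have "u \<le> d - 1" by simp
    then show ?thesis
    proof (induction u rule: inc_induct)
      case base
      then show ?case using top a by simp
    next
      case (step u)
      then have u: "Suc u < d" by simp
      show ?case unfolding qS[OF u] by (rule extract_row(1)[OF n u step.IH])
    qed
  qed
  have "pt_step n m (Suc u) (q u) = p_step n m (Suc u) (q (Suc u))" if "Suc u < d" for u
    using extract_row(2)[OF n that asm[OF that]] qS[OF that] by simp
  then have "chain d n m q" using asm qS unfolding chain_def by blast
  then show thesis using that top by blast
qed

lemma comp_perm_one [simp]: "comp_perm (Suc 0) s = id"
  by (simp add: comp_perm_def)

lemma comp_perm_Suc: "comp_perm (Suc (Suc u)) s = s (Suc u) \<circ> comp_perm (Suc u) s"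
  by (simp add: comp_perm_def)

lemma comp_perm_cong:
  "(\<And>u. 1 \<le> u \<Longrightarrow> u < d \<Longrightarrow> s u = t u) \<Longrightarrow> comp_perm d s = comp_perm d t"
  unfolding comp_perm_def by (intro fold_cong) auto

lemma bij_comp_perm:
  assumes "\<And>u. 1 \<le> u \<Longrightarrow> u \<le> v \<Longrightarrow> bij (s u)"
  shows "bij (comp_perm (Suc v) s)"
  using assms by (induction v) (auto simp: comp_perm_Suc intro!: bij_comp)

lemma comp_perm_fixes:
  assumes "\<And>u. 1 \<le> u \<Longrightarrow> u \<le> v \<Longrightarrow> s u i = i"
  shows "comp_perm (Suc v) s i = i"
  using assms by (induction v) (auto simp: comp_perm_Suc)

text \<open>
  The permutation of row indices, on the residue class of \<open>j\<close>, by which the rows \<open>0, \<dots>, v\<close> are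
  merged; at \<open>v = d - 1\<close> this is the common value of the two families of composed permutations.
\<close>

definition sigma :: "nat \<Rightarrow> nat \<Rightarrow> (nat \<Rightarrow> nat \<Rightarrow> int) \<Rightarrow> nat \<Rightarrow> nat \<Rightarrow> nat \<Rightarrow> nat" where
  "sigma n m q v j = comp_perm (Suc v) (\<lambda>u. cyc (idx n (p_step n m u (q u)) j u) u)"

lemma chainD:
  assumes "chain d n m q"
  shows "u < d \<Longrightarrow> assembled d n m u (q u)"
    and "Suc u < d \<Longrightarrow> pt_step n m (Suc u) (q u) = p_step n m (Suc u) (q (Suc u))"
    and "Suc u < d \<Longrightarrow> q u = q (Suc u) \<circ> transfer n (p_step n m (Suc u) (q (Suc u))) (Suc u)"
  using assms unfolding chain_def by blast+

lemma sigma_fixes: "v < i \<Longrightarrow> sigma n m q v j i = i"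
  unfolding sigma_def by (intro comp_perm_fixes) (simp add: cyc_def)

context
  fixes d n m :: nat and q :: "nat \<Rightarrow> nat \<Rightarrow> int"
  assumes n: "0 < n" and chain: "chain d n m q"
begin

lemma chain_p_le: "u < d \<Longrightarrow> p_step n m u (q u) \<le> u * n"
  by (rule assembled_p_step(1)[OF n _ chainD(1)[OF chain]])

lemma chain_lift: "u < d \<Longrightarrow> q 0 = q u \<circ> lift n (sigma n m q u)"
proof (induction u)
  case 0
  have "sigma n m q 0 = (\<lambda>j. id)" by (simp add: sigma_def fun_eq_iff)
  then show ?case by (simp only: lift_id comp_id)
next
  case (Suc u)
  have "q 0 = q (Suc u) \<circ> (transfer n (p_step n m (Suc u) (q (Suc u))) (Suc u) \<circ> lift n (sigma n m q u))"
  proof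
    fix x
    have "q 0 x = q u (lift n (sigma n m q u) x)" using fun_cong[OF Suc.IH, of x] Suc.prems by simp
    then show "q 0 x = (q (Suc u) \<circ>
        (transfer n (p_step n m (Suc u) (q (Suc u))) (Suc u) \<circ> lift n (sigma n m q u))) x"
      using fun_cong[OF chainD(3)[OF chain Suc.prems], of "lift n (sigma n m q u) x"] by simp
  qed
  also have "transfer n (p_step n m (Suc u) (q (Suc u))) (Suc u) \<circ> lift n (sigma n m q u)
      = lift n (sigma n m q (Suc u))"
    unfolding transfer_def lift_comp[OF n, symmetric] by (simp add: sigma_def[abs_def] comp_perm_Suc)
  finally show ?case .
qed

lemma bij_sigma: "v < d \<Longrightarrow> bij (sigma n m q v j)"
  unfolding sigma_def by (intro bij_comp_perm bij_cyc idx_le chain_p_le) simp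

end

section \<open>Ranks\<close>

definition rank :: "nat \<Rightarrow> nat \<Rightarrow> (nat \<Rightarrow> int) \<Rightarrow> nat \<Rightarrow> int" where
  "rank n m y x = int m * int x - int n * y x"

lemma rank_inj: "0 < n \<Longrightarrow> rank n m y = rank n m z \<Longrightarrow> y = z"
  by (simp add: rank_def fun_eq_iff)

text \<open>
  The correction term \<open>(i' - i) * m\<close> in the definitions of \<open>Psi_coord\<close> and \<open>Phi\<close> is exactly what makes
  ranks move along with the entries: the rank at \<open>(i, j)\<close> of the new family is the rank at \<open>(i', j)\<close>
  of the old one.
\<close>

lemma rank_reindex:
  assumes n: "0 < n" and y: "y \<in> extensional {..<d * n}"
    and fixes_ge: "\<And>i j. d \<le> i \<Longrightarrow> j < n \<Longrightarrow> t j i = i"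
  shows "rank n m (\<lambda>x\<in>{..<d * n}. let i = x div n; j = x mod n; i' = t j i
     in y (i' * n + j) - (int i' - int i) * int m) = rank n m y \<circ> lift n t"
proof
  fix x
  let ?i = "x div n" and ?j = "x mod n"
  have x: "int x = int ?i * int n + int ?j"
    by (metis div_mult_mod_eq of_nat_add of_nat_mult)
  show "rank n m (\<lambda>x\<in>{..<d * n}. let i = x div n; j = x mod n; i' = t j i
     in y (i' * n + j) - (int i' - int i) * int m) x = (rank n m y \<circ> lift n t) x"
  proof (cases "x < d * n")
    case True
    then show ?thesis by (simp add: rank_def lift_def Let_def x) (simp add: algebra_simps)
  next
    case False
    then have "d \<le> ?i" using n by (simp add: less_eq_div_iff_mult_less_eq)
    then have "lift n t x = x" using fixes_ge[of ?i ?j] n by (simp add: lift_def)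
    then show ?thesis using False y by (simp add: rank_def extensional_def)
  qed
qed

lemma p_step_cong:
  assumes "0 < n" "\<And>x. x < Suc u * n \<Longrightarrow> r x = r' x"
  shows "p_step n m u r = p_step n m u r'"
proof -
  have "{x. x \<le> u * n \<and> r x \<le> r (x + n - 1) + int m} = {x. x \<le> u * n \<and> r' x \<le> r' (x + n - 1) + int m}"
    using assms(2) assms(1) by (intro Collect_cong conj_cong refl) auto
  then show ?thesis by (simp add: p_step_def)
qed

context
  fixes d n m :: nat and q :: "nat \<Rightarrow> nat \<Rightarrow> int"
  assumes n: "0 < n" and d: "0 < d" and chain: "chain d n m q"
begin

text \<open>
  The family \<open>rk\<close> forgets the rows that have been cut out, so it agrees with the chain only on the path.
\<close>

lemma chain_rk:
  assumes y: "rank n m y = q (d - 1)"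
  shows "k < d \<Longrightarrow> x < (d - k) * n \<Longrightarrow> rk d n m y k x = q (d - 1 - k) x"
proof (induction k arbitrary: x)
  case 0
  then show ?case using fun_cong[OF y, of x] by (simp add: rank_def)
next
  case (Suc k)
  define u where "u = d - 1 - Suc k"
  have u: "d - 1 - k = Suc u" "d - k = Suc (Suc u)" "d - Suc k = Suc u" "Suc u < d"
    using Suc.prems by (auto simp: u_def)
  have IH: "rk d n m y k x = q (Suc u) x" if "x < Suc (Suc u) * n" for x
    using Suc.IH[of x] Suc.prems(1) that u by simp
  have p: "p_step n m (Suc u) (rk d n m y k) = p_step n m (Suc u) (q (Suc u))"
    by (rule p_step_cong[OF n]) (simp add: IH)
  have x: "x < Suc u * n" using Suc.prems(2) u by simp
  note T = comp_transfer[OF n chain_p_le[OF n chain u(4)], of _ "q (Suc u)",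
      folded chainD(3)[OF chain u(4)]]
  have "rk d n m y (Suc k) x = q u x"
    using T(1)[of x] T(2)[of x] x IH[of x] IH[of "x + n"] by (simp add: u(3) p)
  then show ?case by (simp add: u_def)
qed

lemma chain_p_of:
  assumes y: "rank n m y = q (d - 1)" and u: "u < d"
  shows "p_of d n m y u = p_step n m u (q u)"
  unfolding p_of_def
  by (rule p_step_cong[OF n]) (use chain_rk[OF y, of "d - u - 1"] u in auto)

lemma chain_s_of:
  assumes y: "rank n m y = q (d - 1)"
  shows "s_of d n m y j = sigma n m q (d - 1) j"
  unfolding s_of_def sigma_def using d chain_p_of[OF y]
  by (auto simp: s_step_def[abs_def] i_of_def intro: comp_perm_cong)

lemma chain_Psi_coord:
  assumes y: "rank n m y = q (d - 1)" and extens: "y \<in> extensional {..<d * n}"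
  shows "rank n m (Psi_coord d n m y) = q 0"
proof -
  have "rank n m (Psi_coord d n m y) = rank n m y \<circ> lift n (s_of d n m y)"
    unfolding Psi_coord_def
    by (rule rank_reindex[OF n extens]) (use d in \<open>simp add: chain_s_of[OF y] sigma_fixes\<close>)
  also have "s_of d n m y = sigma n m q (d - 1)" by (rule ext) (rule chain_s_of[OF y])
  also have "rank n m y \<circ> lift n (sigma n m q (d - 1)) = q 0"
    using chain_lift[OF n chain, of "d - 1"] d y by simp
  finally show ?thesis .
qed

lemma chain_rkt:
  assumes c: "rank n m (coord d n m \<Delta>) = q 0"
  shows "u < d \<Longrightarrow> rkt d n m \<Delta> u = q u"
proof (induction u)
  case 0
  then show ?case by (simp add: c[symmetric] rank_def fun_eq_iff)
next
  case (Suc u)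
  let ?p = "p_step n m (Suc u) (q (Suc u))"
  note p = chainD(2)[OF chain Suc.prems] and pn = chain_p_le[OF n chain Suc.prems]
  note step = chainD(3)[OF chain Suc.prems]
  note T = comp_transfer[OF n pn, of _ "q (Suc u)", folded step]
  have above: "q u x = q (Suc u) x" if "Suc (Suc u) * n \<le> x" for x
    using transfer_above[OF n pn that] fun_cong[OF step, of x] by simp
  have IH: "rkt d n m \<Delta> u = q u" using Suc by simp
  show ?case
  proof
    fix x
    consider "x < ?p" | "Suc (Suc u) * n \<le> x" | "?p \<le> x" "x < ?p + n" | "?p + n \<le> x" "x < Suc (Suc u) * n"
      by linarith
    then show "rkt d n m \<Delta> (Suc u) x = q (Suc u) x"
    proof cases
      case 1
      then show ?thesis using T(1)[of x] by (simp add: IH p)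
    next
      case 2
      then show ?thesis using above[of x] by (simp add: IH p)
    next
      case 3
      then show ?thesis using T(3)[of x] pn by (simp add: IH p row_def)
    next
      case 4
      then show ?thesis using T(2)[of "x - n"] by (simp add: IH p)
    qed
  qed
qed

lemma chain_pt_of:
  assumes c: "rank n m (coord d n m \<Delta>) = q 0" and u: "1 \<le> u" "u < d"
  shows "pt_of d n m \<Delta> u = p_step n m u (q u)"
  using chain_rkt[OF c, of "u - 1"] chainD(2)[OF chain, of "u - 1"] u by (simp add: pt_of_def)

lemma chain_st_of:
  assumes c: "rank n m (coord d n m \<Delta>) = q 0"
  shows "st_of d n m \<Delta> j = sigma n m q (d - 1) j"
  unfolding st_of_def sigma_def using d chain_pt_of[OF c]
  by (auto simp: st_step_def[abs_def] it_of_def intro: comp_perm_cong)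

lemma chain_Phi:
  assumes c: "rank n m (coord d n m \<Delta>) = q 0" and extens: "coord d n m \<Delta> \<in> extensional {..<d * n}"
  shows "rank n m (Phi d n m \<Delta>) = q (d - 1)"
proof -
  note bij = bij_sigma[OF n chain, of "d - 1"]
  have d1: "d - 1 < d" using d by simp
  have fix_inv: "inv (sigma n m q (d - 1) j) i = i" if "d \<le> i" for i j
    using sigma_fixes[of "d - 1" i n m q j] bij[OF d1, of j] that d
    by (metis One_nat_def Suc_le_lessD Suc_pred bij_inv_eq_iff)
  have "rank n m (Phi d n m \<Delta>) = rank n m (coord d n m \<Delta>) \<circ> lift n (\<lambda>j. inv (st_of d n m \<Delta> j))"
    unfolding Phi_def by (rule rank_reindex[OF n extens]) (simp add: chain_st_of[OF c] fix_inv del: One_nat_def)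
  also have "(\<lambda>j. inv (st_of d n m \<Delta> j)) = (\<lambda>j. inv (sigma n m q (d - 1) j))"
    by (simp add: chain_st_of[OF c])
  also have "lift n (\<lambda>j. inv (sigma n m q (d - 1) j)) = inv (lift n (sigma n m q (d - 1)))"
    by (rule bij_lift(2)[symmetric, OF n]) (rule bij[OF d1])
  also have "rank n m (coord d n m \<Delta>) \<circ> inv (lift n (sigma n m q (d - 1))) = q (d - 1)"
  proof -
    have "bij (lift n (sigma n m q (d - 1)))" by (rule bij_lift(1)[OF n]) (rule bij[OF d1])
    then have "lift n (sigma n m q (d - 1)) \<circ> inv (lift n (sigma n m q (d - 1))) = id"
      using bij_is_surj surj_iff by blast
    then show ?thesis unfolding c chain_lift[OF n chain d1] comp_assoc by simp
  qed
  finally show ?thesis .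
qed

end

section \<open>Residues, generators and coordinates\<close>

lemma hat_a_int: "int (hat_a d n m i j) = int i + int d * (int m * int j + int m * int n * int i)"
  by (simp add: hat_a_def algebra_simps)

lemma int_le_div_iff:
  fixes a b t :: int
  assumes "0 < b"
  shows "t \<le> a div b \<longleftrightarrow> t * b \<le> a"
proof
  assume "t \<le> a div b"
  then have "t * b \<le> a div b * b" using assms by (intro mult_right_mono) auto
  also have "\<dots> \<le> a" using assms by (metis div_mult_mod_eq le_add_same_cancel1 pos_mod_sign)
  finally show "t * b \<le> a" .
next
  assume "t * b \<le> a"
  then show "t \<le> a div b"
    using assms by (metis zdiv_mono1 nonzero_mult_div_cancel_right less_irrefl)
qed

lemma hat_a_div: "i < d \<Longrightarrow> j < n \<Longrightarrow> hat_a d n m i j div (d * n) = bnd n m (i * n + j)"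
proof -
  assume i: "i < d" and j: "j < n"
  have "hat_a d n m i j = i + (j * m + m * n * i) * d" by (simp add: hat_a_def algebra_simps)
  then have "hat_a d n m i j div d = j * m + m * n * i" using i by simp
  then have "hat_a d n m i j div (d * n) = (j * m + m * i * n) div n"
    by (simp add: div_mult2_eq algebra_simps)
  also have "\<dots> = bnd n m (i * n + j)" using j by (simp add: bnd_def)
  finally show ?thesis .
qed

text \<open>The upper bound for a coordinate is the largest value for which the generator is a natural number.\<close>

lemma bnd_iff:
  assumes "i < d" "j < n"
  shows "t \<le> int (bnd n m (i * n + j)) \<longleftrightarrow> 0 \<le> int (hat_a d n m i j) - int (d * n) * t"
proof -
  have "t \<le> int (hat_a d n m i j) div int (d * n) \<longleftrightarrow> t * int (d * n) \<le> int (hat_a d n m i j)"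
    using assms by (intro int_le_div_iff) simp
  moreover have "int (bnd n m (i * n + j)) = int (hat_a d n m i j) div int (d * n)"
    unfolding hat_a_div[OF assms, symmetric] by (rule zdiv_int)
  ultimately show ?thesis by (simp add: mult.commute)
qed

lemma index_less:
  fixes i j :: nat
  shows "i < d \<Longrightarrow> j < n \<Longrightarrow> i * n + j < d * n"
proof -
  assume "i < d" "j < n"
  then have "i * n + j < Suc i * n" "Suc i * n \<le> d * n" by (simp, intro mult_right_mono) auto
  then show ?thesis by (rule less_le_trans)
qed

lemma Gam_dn: "b \<in> \<Delta> \<Longrightarrow> \<forall>g\<in>Gam d n m. \<forall>b\<in>\<Delta>. g + b \<in> \<Delta> \<Longrightarrow> b + d * n \<in> \<Delta>"
  using Gam_gen[of "d * n" d n m] by (auto simp: add.commute)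

lemma Gam_mult: "g \<in> Gam d n m \<Longrightarrow> k * g \<in> Gam d n m"
  by (induction k) (auto intro: Gam_zero Gam_add)

context
  fixes d n m :: nat
  assumes d: "0 < d" and n: "0 < n" and coprime: "coprime m n"
begin

text \<open>
  Reduction modulo \<open>d\<close> recovers \<open>i\<close>; then reduction of the quotient modulo \<open>n\<close>, where \<open>m\<close> is invertible,
  recovers \<open>j\<close>. Together with the next lemma: the numbers \<open>hat_a d n m i j\<close> represent each residue
  class modulo \<open>d * n\<close> exactly once.
\<close>

lemma hat_a_inj:
  assumes "i < d" "j < n" "i' < d" "j' < n"
    and eq: "int (hat_a d n m i j) - int (d * n) * s = int (hat_a d n m i' j') - int (d * n) * t"
  shows "i = i'" "j = j'" "s = t"
proof -
  let ?w = "\<lambda>i j s. int m * int j + int m * int n * int i - int n * s"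
  have e: "int i + int d * ?w i j s = int i' + int d * ?w i' j' t"
    using eq by (simp add: hat_a_int algebra_simps)
  then have "(int i + int d * ?w i j s) mod int d = (int i' + int d * ?w i' j' t) mod int d" by (rule arg_cong)
  then have "int i mod int d = int i' mod int d" by simp
  then show ii: "i = i'" using assms(1,3) by simp
  have w: "?w i j s = ?w i' j' t" using e ii d by simp
  then have "int m * (int j - int j') = int n * (s - t)" using ii by (simp add: algebra_simps)
  then have "int n dvd int m * (int j - int j')" by simp
  moreover have "Rings.coprime (int n) (int m)" using coprime by (simp add: coprime_commute)
  ultimately have "int n dvd int j - int j'" by (simp add: coprime_dvd_mult_right_iff)
  then have "int j mod int n = int j' mod int n" by (simp add: mod_eq_dvd_iff)
  then show jj: "j = j'" using assms(2,4) by simp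
  show "s = t" using w ii jj n by simp
qed

lemma hat_a_cover:
  fixes b :: int
  obtains i j t where "i < d" "j < n" "b = int (hat_a d n m i j) - int (d * n) * t" "int i = b mod int d"
proof -
  define i where "i = nat (b mod int d)"
  have i: "int i = b mod int d" "i < d" using d by (simp_all add: i_def nat_less_iff)
  define e where "e = b div int d - int m * int n * int i"
  obtain w where w: "[int m * w = 1] (mod int n)"
    using cong_solve_coprime_int[of "int m" "int n"] coprime by auto
  define j where "j = nat (e * w mod int n)"
  have j: "int j = e * w mod int n" "j < n" using n by (simp_all add: j_def nat_less_iff)
  have "[int m * int j = int m * (e * w)] (mod int n)"
    unfolding j by (intro cong_mult cong_refl) simp
  also have "int m * (e * w) = e * (int m * w)" by simp
  also have "[e * (int m * w) = e * 1] (mod int n)" by (intro cong_mult cong_refl w)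
  finally have "int n dvd int m * int j - e" by (simp add: cong_iff_dvd_diff)
  then obtain t where t: "int m * int j - e = int n * t" by (rule dvdE)
  have "b = int i + int d * (b div int d)" using i by simp
  also have "b div int d = e + int m * int n * int i" by (simp add: e_def)
  also have "e = int m * int j - int n * t" using t by simp
  finally have "b = int (hat_a d n m i j) - int (d * n) * t"
    by (simp add: hat_a_int algebra_simps)
  then show thesis using that i j by blast
qed

text \<open>
  Membership of \<open>b\<close> depends only on how far \<open>b\<close> lies below the representative of its residue class. All
  closure conditions are translated into inequalities between coordinates by this equivalence.
\<close>

lemma mem_of_coord:
  assumes "i < d" "j < n" "int b = int (hat_a d n m i j) - int (d * n) * t"
  shows "b \<in> of_coord d n m c \<longleftrightarrow> t \<le> c (i * n + j)"
proof
  assume "b \<in> of_coord d n m c"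
  then obtain i' j' k where b: "i' < d" "j' < n"
    "int b = int (hat_a d n m i' j') - int (d * n) * c (i' * n + j') + int (d * n) * int k"
    by (auto simp: of_coord_def)
  then have "int (hat_a d n m i j) - int (d * n) * t
      = int (hat_a d n m i' j') - int (d * n) * (c (i' * n + j') - int k)"
    using assms(3) by (simp add: algebra_simps)
  from hat_a_inj[OF assms(1,2) b(1,2) this] show "t \<le> c (i * n + j)" by simp
next
  assume t: "t \<le> c (i * n + j)"
  then have "int b = int (hat_a d n m i j) - int (d * n) * c (i * n + j)
      + int (d * n) * int (nat (c (i * n + j) - t))"
    using assms(3) by (simp add: algebra_simps)
  then show "b \<in> of_coord d n m c" using assms(1,2) unfolding of_coord_def by blast
qed

text \<open>
  Families with the same generators coincide, since the residue of a generator determines its index.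
\<close>

lemma coord_unique:
  assumes "c \<in> extensional {..<d * n}" "c' \<in> extensional {..<d * n}"
    and alpha: "\<And>i j. i < d \<Longrightarrow> j < n \<Longrightarrow> \<exists>i'<d. \<exists>j'<n.
      int (hat_a d n m i j) - int (d * n) * c (i * n + j) = int (hat_a d n m i' j') - int (d * n) * c' (i' * n + j')"
  shows "c = c'"
proof (rule extensionalityI[OF assms(1,2)])
  fix x assume "x \<in> {..<d * n}"
  then have x: "x div n < d" "x mod n < n" using n by (auto intro: less_mult_imp_div_less)
  from alpha[OF x] obtain i' j' where ij: "i' < d" "j' < n"
    "int (hat_a d n m (x div n) (x mod n)) - int (d * n) * c (x div n * n + x mod n)
      = int (hat_a d n m i' j') - int (d * n) * c' (i' * n + j')" by blast
  from hat_a_inj[OF x ij] show "c x = c' x" by (metis div_mult_mod_eq)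
qed

lemma gens_of_coord:
  assumes c: "\<And>i j. i < d \<Longrightarrow> j < n \<Longrightarrow> c (i * n + j) \<le> int (bnd n m (i * n + j))"
  shows "int ` gens d n (of_coord d n m c) =
       {int (hat_a d n m i j) - int (d * n) * c (i * n + j) | i j. i < d \<and> j < n}"
proof -
  have dn: "0 < d * n" using d n by simp
  have up: "b + d * n \<in> of_coord d n m c" if "b \<in> of_coord d n m c" for b
  proof -
    obtain i j t where b: "i < d" "j < n" "int b = int (hat_a d n m i j) - int (d * n) * t"
      using hat_a_cover[of "int b"] by blast
    then have "int (b + d * n) = int (hat_a d n m i j) - int (d * n) * (t - 1)" by (simp add: algebra_simps)
    from mem_of_coord[OF b(1,2) this] mem_of_coord[OF b] that show ?thesis by simp
  qed
  note gens = gens_eq[OF dn up]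
  show ?thesis
  proof (intro equalityI subsetI)
    fix a' assume "a' \<in> int ` gens d n (of_coord d n m c)"
    then obtain a where a: "a' = int a" "a \<in> of_coord d n m c" "\<And>b. b \<in> of_coord d n m c \<Longrightarrow> a \<noteq> b + d * n"
      using gens by auto
    obtain i j t where ij: "i < d" "j < n" "int a = int (hat_a d n m i j) - int (d * n) * t"
      using hat_a_cover[of "int a"] by blast
    have t: "t \<le> c (i * n + j)" using mem_of_coord[OF ij] a by simp
    have "\<not> t + 1 \<le> c (i * n + j)"
    proof
      assume t1: "t + 1 \<le> c (i * n + j)"
      define b where "b = nat (int (hat_a d n m i j) - int (d * n) * (t + 1))"
      have "0 \<le> int (hat_a d n m i j) - int (d * n) * (t + 1)"
        using bnd_iff[OF ij(1,2), of "t + 1" m] c[OF ij(1,2)] t1 by linarith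
      then have b: "int b = int (hat_a d n m i j) - int (d * n) * (t + 1)" by (simp add: b_def)
      from mem_of_coord[OF ij(1,2) this] t1 have "b \<in> of_coord d n m c" by simp
      moreover have "int a = int (b + d * n)" using ij(3) b by (simp add: algebra_simps)
      then have "a = b + d * n" by (simp only: of_nat_eq_iff)
      ultimately show False using a(3) by blast
    qed
    then have "t = c (i * n + j)" using t by simp
    then show "a' \<in> {int (hat_a d n m i j) - int (d * n) * c (i * n + j) | i j. i < d \<and> j < n}"
      using ij a(1) by blast
  next
    fix a' assume "a' \<in> {int (hat_a d n m i j) - int (d * n) * c (i * n + j) | i j. i < d \<and> j < n}"
    then obtain i j where ij: "i < d" "j < n" "a' = int (hat_a d n m i j) - int (d * n) * c (i * n + j)"
      by blast
    have "0 \<le> a'" using bnd_iff[OF ij(1,2), of "c (i * n + j)" m] c[OF ij(1,2)] ij(3) by simp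
    then obtain a where a: "a' = int a" using zero_le_imp_eq_int by blast
    have "a \<in> of_coord d n m c" using mem_of_coord[OF ij(1,2) ij(3)[unfolded a]] by simp
    moreover have "a \<noteq> b + d * n" if "b \<in> of_coord d n m c" for b
    proof
      assume "a = b + d * n"
      then have "int b = int (hat_a d n m i j) - int (d * n) * (c (i * n + j) + 1)"
        using ij(3) a by (simp add: algebra_simps)
      from mem_of_coord[OF ij(1,2) this] that show False by simp
    qed
    ultimately have "a \<in> gens d n (of_coord d n m c)" using gens by simp
    then show "a' \<in> int ` gens d n (of_coord d n m c)" using a by simp
  qed
qed

lemma coord_of_coord:
  assumes c: "c \<in> (\<Pi>\<^sub>E x\<in>{..<d * n}. {0..int (bnd n m x)})"
  shows "coord d n m (of_coord d n m c) = c"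
proof -
  have le: "c (i * n + j) \<le> int (bnd n m (i * n + j))" if "i < d" "j < n" for i j
    using PiE_mem[OF c, of "i * n + j"] index_less[OF that] by simp
  have gens: "int ` gens d n (of_coord d n m c) =
      {int (hat_a d n m i j) - int (d * n) * c (i * n + j) | i j. i < d \<and> j < n}"
    by (rule gens_of_coord) (rule le)
  show ?thesis
    unfolding coord_def gens
  proof (rule the_equality)
    fix c' assume c': "c' \<in> (\<Pi>\<^sub>E x\<in>{..<d * n}. {0..int (bnd n m x)}) \<and>
      {int (hat_a d n m i j) - int (d * n) * c (i * n + j) | i j. i < d \<and> j < n} =
      {int (hat_a d n m i j) - int (d * n) * c' (i * n + j) | i j. i < d \<and> j < n}"
    show "c' = c"
    proof (rule coord_unique)
      fix i j assume "i < d" "j < n"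
      then have "int (hat_a d n m i j) - int (d * n) * c' (i * n + j) \<in>
        {int (hat_a d n m i j) - int (d * n) * c' (i * n + j) | i j. i < d \<and> j < n}" by blast
      then show "\<exists>i'<d. \<exists>j'<n. int (hat_a d n m i j) - int (d * n) * c' (i * n + j)
          = int (hat_a d n m i' j') - int (d * n) * c (i' * n + j')"
        unfolding conjunct2[OF c', symmetric] by blast
    qed (use c c' in \<open>auto simp: PiE_def\<close>)
  qed (use c in simp)
qed

text \<open>
  As \<open>0 \<in> \<Delta>\<close>, all representatives lie in \<open>\<Delta>\<close>, and the coordinate measures how far one can descend from
  them in steps of \<open>d * n\<close> without leaving \<open>\<Delta>\<close>.
\<close>

lemma Gam_invariant_eq_of_coord:
  assumes zero: "0 \<in> \<Delta>" and inv: "\<forall>g\<in>Gam d n m. \<forall>b\<in>\<Delta>. g + b \<in> \<Delta>"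
  obtains c where "c \<in> (\<Pi>\<^sub>E x\<in>{..<d * n}. {0..int (bnd n m x)})" "\<Delta> = of_coord d n m c"
proof -
  let ?S = "\<lambda>i j. {k. k \<le> bnd n m (i * n + j) \<and> hat_a d n m i j - d * n * k \<in> \<Delta>}"
  define c where "c = (\<lambda>x\<in>{..<d * n}. int (Max (?S (x div n) (x mod n))))"
  have up: "b + d * n * k \<in> \<Delta>" if "b \<in> \<Delta>" for b k
  proof (induction k)
    case (Suc k)
    from Gam_dn[OF Suc inv] show ?case by (simp add: algebra_simps)
  qed (use that in simp)
  have hat: "hat_a d n m i j \<in> \<Delta>" for i j
  proof -
    have "j * (d * m) + i * (d * m * n + 1) \<in> Gam d n m"
      by (intro Gam_add Gam_mult Gam_gen) auto
    then have "j * (d * m) + i * (d * m * n + 1) + 0 \<in> \<Delta>" using inv zero by blast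
    then show ?thesis by (simp add: hat_a_def algebra_simps)
  qed
  have fin: "finite (?S i j)" for i j by simp
  have Max: "Max (?S i j) \<in> ?S i j" for i j
    using hat[of i j] by (intro Max_in fin) auto
  have cij: "c (i * n + j) = int (Max (?S i j))" if "i < d" "j < n" for i j
    using index_less[OF that] that by (simp add: c_def)
  have "c \<in> (\<Pi>\<^sub>E x\<in>{..<d * n}. {0..int (bnd n m x)})"
  proof (rule PiE_I)
    fix x assume "x \<in> {..<d * n}"
    then show "c x \<in> {0..int (bnd n m x)}" using Max[of "x div n" "x mod n"] by (simp add: c_def)
  qed (simp add: c_def)
  moreover have "\<Delta> = of_coord d n m c"
  proof -
    have "b \<in> \<Delta> \<longleftrightarrow> b \<in> of_coord d n m c" for b
    proof -
      obtain i j t where b: "i < d" "j < n" "int b = int (hat_a d n m i j) - int (d * n) * t"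
        using hat_a_cover[of "int b"] by blast
      have "b \<in> \<Delta> \<longleftrightarrow> t \<le> int (Max (?S i j))"
      proof
        assume bD: "b \<in> \<Delta>"
        show "t \<le> int (Max (?S i j))"
        proof (cases "0 \<le> t")
          case True
          then obtain k where k: "t = int k" using zero_le_imp_eq_int by blast
          have "k \<le> bnd n m (i * n + j)" using bnd_iff[OF b(1,2), of t m] b(3) k by simp
          moreover have "int b = int (hat_a d n m i j) - int (d * n * k)" using b(3) k by simp
          then have "hat_a d n m i j - d * n * k = b" by linarith
          ultimately have "k \<in> ?S i j" using bD by simp
          then show ?thesis using Max_ge[OF fin] k by simp
        qed simp
      next
        assume t: "t \<le> int (Max (?S i j))"
        let ?k = "Max (?S i j)"
        have "int (d * n) * int ?k \<le> int (hat_a d n m i j)"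
          using bnd_iff[OF b(1,2), of "int ?k" m] Max[of i j] by simp
        then have le: "d * n * ?k \<le> hat_a d n m i j" by (simp only: of_nat_mult[symmetric] of_nat_le_iff)
        have "int b = int (hat_a d n m i j - d * n * ?k + d * n * nat (int ?k - t))"
          using b(3) t le by (simp add: algebra_simps)
        then have "b = hat_a d n m i j - d * n * ?k + d * n * nat (int ?k - t)"
          by (simp only: of_nat_eq_iff)
        then show "b \<in> \<Delta>" using up Max[of i j] by simp
      qed
      then show ?thesis using mem_of_coord[OF b] cij[OF b(1,2)] by simp
    qed
    then show ?thesis by blast
  qed
  ultimately show thesis using that by blast
qed

end

section \<open>Ranks of the two kinds of families\<close>

lemma bnd_eq_div: "0 < n \<Longrightarrow> bnd n m x = m * x div n"
proof -
  assume n: "0 < n"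
  have "m * x = m * (x div n * n + x mod n)" by simp
  also have "\<dots> = (x mod n * m) + (m * (x div n)) * n" by (simp only: algebra_simps)
  finally show ?thesis using n by (simp add: bnd_def)
qed

lemma rank_nonneg_iff:
  assumes "0 < n"
  shows "0 \<le> rank n m c x \<longleftrightarrow> c x \<le> int (bnd n m x)"
  using int_le_div_iff[of "int n" "c x" "int (m * x)"] assms
  by (simp add: rank_def bnd_eq_div zdiv_int mult.commute)

text \<open>
  For \<open>u = 0\<close> the only candidate position is \<open>0\<close>, so that the path is itself the window and plays the
  role of row \<open>0\<close>.
\<close>

lemma assembled_bottom_iff:
  assumes n: "0 < n" and d: "0 < d"
  shows "assembled d n m 0 q \<longleftrightarrow> q 0 = 0 \<and> (\<forall>x<d * n. 0 \<le> q x) \<and>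
    (\<forall>i<d. \<forall>x. row n q i (Suc x) \<le> row n q i x + int m) \<and>
    (\<forall>i. Suc i < d \<longrightarrow> (\<exists>x. row n q (Suc i) (Suc x) \<le> row n q i x + int m))"
    (is "?L \<longleftrightarrow> ?R")
proof
  assume L: ?L
  note A = assembledD[OF L]
  have p: "p_step n m 0 q = 0" using assembled_p_step(1)[OF n d L] by simp
  have "row n q 0 (Suc x) \<le> row n q 0 x + int m" for x
    by (rule window_cyclic[OF n d L]) (simp add: p row_def)
  then have "row n q i (Suc x) \<le> row n q i x + int m" if "i < d" for i x
    using A(4)[of i x] that by (cases i) auto
  moreover have "\<exists>x. row n q (Suc i) (Suc x) \<le> row n q i x + int m" if i: "Suc i < d" for i
  proof (cases i)
    case 0
    then obtain x where "x < n" "row n q (Suc i) (Suc x) \<le> q x + int m" using A(6) i p by auto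
    then show ?thesis using 0 by (intro exI[of _ x]) (simp add: row_def)
  next
    case (Suc k)
    then show ?thesis using A(5)[of i] i by simp
  qed
  ultimately show ?R using A(1,2) by blast
next
  assume R: ?R
  have "n - 1 < n" "n \<le> d * n" using n d by simp_all
  then have "n - 1 < d * n" by (rule less_le_trans)
  then have "0 \<le> q (n - 1)" "q 0 = 0" using R by blast+
  then have "q 0 \<le> q (n - 1) + int m" by simp
  from p_step_bounds(1)[OF this, of 0] have p: "p_step n m 0 q = 0" by simp
  have "q (Suc x) \<le> q x + int m" if "Suc x < n" for x
  proof -
    have "row n q 0 (Suc x) \<le> row n q 0 x + int m" using R d by blast
    then show ?thesis using that by (simp add: row_def)
  qed
  moreover have "\<exists>x. 0 \<le> x \<and> x < n \<and> row n q (Suc 0) (Suc x) \<le> q x + int m" if d1: "Suc 0 < d"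
  proof -
    obtain x where x: "row n q (Suc 0) (Suc x) \<le> row n q 0 x + int m" using R d1 by blast
    have "row n q (Suc 0) (Suc (x mod n)) = row n q (Suc 0) (Suc x)"
      by (simp add: row_def mod_Suc_eq)
    then show ?thesis using x n by (intro exI[of _ "x mod n"]) (simp add: row_def)
  qed
  ultimately show ?L using R unfolding assembled_def p by simp
qed

lemma assembled_top_iff:
  "0 < d \<Longrightarrow> assembled d n m (d - 1) q \<longleftrightarrow> q 0 = 0 \<and> (\<forall>x<d * n. 0 \<le> q x) \<and>
    (\<forall>x. Suc x < d * n \<longrightarrow> q (Suc x) \<le> q x + int m)"
  unfolding assembled_def by auto

lemma Yset_iff:
  assumes n: "0 < n" and d: "0 < d"
  shows "y \<in> Yset d n m \<longleftrightarrow> y \<in> extensional {..<d * n} \<and> assembled d n m (d - 1) (rank n m y)"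
proof -
  have step: "rank n m y (Suc x) \<le> rank n m y x + int m \<longleftrightarrow> y x \<le> y (x + 1)" for x
    using n by (simp add: rank_def algebra_simps)
  have zero: "rank n m y 0 = 0 \<longleftrightarrow> y 0 = 0" using n by (simp add: rank_def)
  have "y \<in> Yset d n m \<longleftrightarrow> y \<in> extensional {..<d * n} \<and> y 0 = 0 \<and>
      (\<forall>x<d * n. y x \<le> int (bnd n m x)) \<and> (\<forall>x. Suc x < d * n \<longrightarrow> y x \<le> y (x + 1))"
    (is "_ \<longleftrightarrow> ?R")
  proof
    assume y: "y \<in> Yset d n m"
    then have "y \<in> (\<Pi>\<^sub>E x\<in>{..<d * n}. {0..int (bnd n m x)})" by (simp add: Yset_def)
    from PiE_mem[OF this, of 0] have "y 0 = 0" using n d by (simp add: bnd_def)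
    then show ?R using y by (auto simp: Yset_def PiE_iff)
  next
    assume R: ?R
    have "x < d * n \<Longrightarrow> 0 \<le> y x" for x
    proof (induction x)
      case (Suc x)
      then show ?case using R by force
    qed (use R in simp)
    then show "y \<in> Yset d n m" using R by (auto simp: Yset_def PiE_iff)
  qed
  then show ?thesis
    unfolding assembled_top_iff[OF d] step zero rank_nonneg_iff[OF n] by simp
qed

lemma row_add_le:
  assumes "\<And>x. row n q i (Suc x) \<le> row n q i x + int m"
  shows "row n q i (x + t) \<le> row n q i x + int m * int t"
proof (induction t)
  case (Suc t)
  then show ?case using assms[of "x + t"] by (simp add: algebra_simps)
qed simp

text \<open>
  Go forward along row \<open>k\<close> from \<open>x\<close> to the place of the link, change to row \<open>k + 1\<close>, and continue there
  to \<open>x + n\<close>: these are \<open>n\<close> steps, each rising by at most \<open>m\<close>.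
\<close>

lemma linked_rows_vertical:
  assumes n: "0 < n"
    and cyc: "\<And>i x. i \<in> {k, Suc k} \<Longrightarrow> row n q i (Suc x) \<le> row n q i x + int m"
    and link: "row n q (Suc k) (Suc x0) \<le> row n q k x0 + int m"
  shows "row n q (Suc k) x \<le> row n q k x + int m * int n"
proof -
  obtain y where y: "x \<le> y" "y < x + n" "y mod n = x0 mod n" using window_representative[OF n] .
  have "Suc y mod n = Suc x0 mod n" using y(3) by (metis mod_Suc_eq)
  then have link': "row n q (Suc k) (Suc y) \<le> row n q k y + int m"
    using link y(3) by (simp add: row_def)
  have "row n q (Suc k) x = row n q (Suc k) (Suc y + (x + n - Suc y))" using y by simp
  also have "\<dots> \<le> row n q (Suc k) (Suc y) + int m * int (x + n - Suc y)"
    by (rule row_add_le) (simp add: cyc)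
  also have "\<dots> \<le> row n q k y + int m * int (Suc (x + n - Suc y))"
    using link' by (simp add: algebra_simps)
  also have "row n q k y \<le> row n q k x + int m * int (y - x)"
    using row_add_le[of n q k m x "y - x"] cyc y by simp
  also have "row n q k x + int m * int (y - x) + int m * int (Suc (x + n - Suc y))
      = row n q k x + int m * (int (y - x) + int (Suc (x + n - Suc y)))"
    by (simp add: algebra_simps)
  also have "int (y - x) + int (Suc (x + n - Suc y)) = int n" using y by simp
  finally show ?thesis by simp
qed

text \<open>
  The quotient \<open>Suc (x mod n) div n\<close> is \<open>1\<close> if the step from \<open>x\<close> to \<open>x + 1\<close> leads from the end of a row to its
  start, and \<open>0\<close> otherwise. Keeping it as a term treats both cases at once.
\<close>

lemma Suc_mod_wrap:
  fixes x :: nat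
  shows "int (x mod n) + 1 = int (Suc (x mod n) div n) * int n + int (Suc x mod n)"
proof -
  have "Suc (x mod n) = Suc (x mod n) div n * n + Suc (x mod n) mod n" by simp
  then have "int (Suc (x mod n)) = int (Suc (x mod n) div n * n + Suc (x mod n) mod n)" by (rule arg_cong)
  then show ?thesis by (simp add: mod_Suc_eq)
qed

lemma row_rank_step_iff:
  assumes n: "0 < n"
  shows "row n (rank n m c) i (Suc x) \<le> row n (rank n m c) i x + int m \<longleftrightarrow>
   c (i * n + x mod n) - int m * int (Suc (x mod n) div n) \<le> c (i * n + Suc x mod n)"
proof -
  let ?w = "int (Suc (x mod n) div n)"
  have e: "int (Suc x mod n) = int (x mod n) + 1 - ?w * int n" using Suc_mod_wrap[of x] by simp
  have "row n (rank n m c) i x + int m - row n (rank n m c) i (Suc x)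
      = int n * (c (i * n + Suc x mod n) - (c (i * n + x mod n) - int m * ?w))"
    by (simp add: row_def rank_def e algebra_simps)
  moreover have "0 \<le> int n * z \<longleftrightarrow> 0 \<le> z" for z using n by (simp add: zero_le_mult_iff)
  ultimately show ?thesis by (metis diff_ge_0_iff_ge)
qed

lemma row_rank_link_iff:
  assumes n: "0 < n"
  shows "row n (rank n m c) (Suc i) (Suc x) \<le> row n (rank n m c) i x + int m \<longleftrightarrow>
   c (i * n + x mod n) + int m - int m * int (Suc (x mod n) div n) \<le> c (Suc i * n + Suc x mod n)"
proof -
  let ?w = "int (Suc (x mod n) div n)"
  have e: "int (Suc x mod n) = int (x mod n) + 1 - ?w * int n" using Suc_mod_wrap[of x] by simp
  have "row n (rank n m c) i x + int m - row n (rank n m c) (Suc i) (Suc x)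
      = int n * (c (Suc i * n + Suc x mod n) - (c (i * n + x mod n) + int m - int m * ?w))"
    by (simp add: row_def rank_def e algebra_simps)
  moreover have "0 \<le> int n * z \<longleftrightarrow> 0 \<le> z" for z using n by (simp add: zero_le_mult_iff)
  ultimately show ?thesis by (metis diff_ge_0_iff_ge)
qed

lemma hat_a_wrap:
  "int (hat_a d n m i (x mod n)) + int (d * m)
    = int (hat_a d n m i (Suc x mod n)) + int (d * n) * (int m * int (Suc (x mod n) div n))"
proof -
  let ?w = "int (Suc (x mod n) div n)"
  have e: "int (Suc x mod n) = int (x mod n) + 1 - ?w * int n" using Suc_mod_wrap[of x] by simp
  show ?thesis unfolding hat_a_int e by (simp add: algebra_simps)
qed

lemma hat_a_Suc: "int (hat_a d n m (Suc i) j) = int (hat_a d n m i j) + int (d * n) * int m + 1"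
  by (simp add: hat_a_int algebra_simps)

context
  fixes d n m :: nat
  assumes d: "0 < d" and n: "0 < n"
begin

lemma assembled_bottom_vertical:
  assumes a: "assembled d n m 0 (rank n m c)" and i: "Suc i < d" "j < n"
  shows "c (i * n + j) \<le> c (Suc i * n + j)"
proof -
  note A = a[unfolded assembled_bottom_iff[OF n d]]
  obtain x0 where "row n (rank n m c) (Suc i) (Suc x0) \<le> row n (rank n m c) i x0 + int m"
    using A i by blast
  then have "row n (rank n m c) (Suc i) j \<le> row n (rank n m c) i j + int m * int n"
    using A i by (intro linked_rows_vertical[OF n]) auto
  then have "int n * c (i * n + j) \<le> int n * c (Suc i * n + j)"
    using i(2) by (simp add: row_def rank_def algebra_simps)
  then show ?thesis using n by simp
qed

text \<open>
  The upper bound is nonnegativity of the ranks. The lower bound follows from the value \<open>0\<close> at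
  the origin, as coordinates increase along row \<open>0\<close> and from each row to the next.
\<close>

lemma assembled_bottom_bounds:
  assumes a: "assembled d n m 0 (rank n m c)" and ext: "c \<in> extensional {..<d * n}"
  shows "c \<in> (\<Pi>\<^sub>E x\<in>{..<d * n}. {0..int (bnd n m x)})"
proof -
  note A = a[unfolded assembled_bottom_iff[OF n d]]
  have nonneg: "i < d \<Longrightarrow> j < n \<Longrightarrow> 0 \<le> c (i * n + j)" for i j
  proof (induction i)
    case 0
    have "row n (rank n m c) 0 (0 + j) \<le> row n (rank n m c) 0 0 + int m * int j"
      by (rule row_add_le) (use A d in blast)
    then have "rank n m c j \<le> int m * int j" using A 0 by (simp add: row_def)
    then show ?case using n by (simp add: rank_def zero_le_mult_iff)
  next
    case (Suc i)
    then show ?case using assembled_bottom_vertical[OF a, of i j] by simp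
  qed
  have "c x \<in> {0..int (bnd n m x)}" if "x < d * n" for x
    using nonneg[of "x div n" "x mod n"] n that A rank_nonneg_iff[OF n, of m c x]
    by (simp add: less_mult_imp_div_less)
  then show ?thesis using ext by (auto simp: PiE_iff)
qed

section \<open>Admissible sets as families of linked cyclic rows\<close>

context
  assumes coprime: "coprime m n"
begin

text \<open>
  The row condition is closure under \<open>d * m\<close>, tested on the generators, and the link is the
  admissibility condition, read off from the coordinates of the generator that it provides.
\<close>

lemma Adm_coord:
  assumes "\<Delta> \<in> Adm d n m"
  shows "of_coord d n m (coord d n m \<Delta>) = \<Delta>" "coord d n m \<Delta> \<in> extensional {..<d * n}"
    "assembled d n m 0 (rank n m (coord d n m \<Delta>))"
proof -
  have zero: "0 \<in> \<Delta>" and inv: "\<forall>g\<in>Gam d n m. \<forall>b\<in>\<Delta>. g + b \<in> \<Delta>"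
    and adm: "\<And>i. i < d \<Longrightarrow> \<exists>a\<in>gens d n \<Delta>. [a = i] (mod d) \<and> a + d * m + 1 \<in> \<Delta>"
    using assms by (auto simp: Adm_def)
  obtain c where c: "c \<in> (\<Pi>\<^sub>E x\<in>{..<d * n}. {0..int (bnd n m x)})" and \<Delta>: "\<Delta> = of_coord d n m c"
    using Gam_invariant_eq_of_coord[OF d n coprime zero inv] .
  have coord: "coord d n m \<Delta> = c" using coord_of_coord[OF d n coprime c] \<Delta> by simp
  show "of_coord d n m (coord d n m \<Delta>) = \<Delta>" "coord d n m \<Delta> \<in> extensional {..<d * n}"
    using coord \<Delta> c by (auto simp: PiE_def)
  have le: "c (i * n + j) \<le> int (bnd n m (i * n + j))" if "i < d" "j < n" for i j
    using PiE_mem[OF c, of "i * n + j"] index_less[OF that] by simp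
  have gens: "int ` gens d n \<Delta> =
      {int (hat_a d n m i j) - int (d * n) * c (i * n + j) | i j. i < d \<and> j < n}"
    unfolding \<Delta> by (rule gens_of_coord[OF d n coprime]) (rule le)
  note mem = mem_of_coord[OF d n coprime, of _ _ _ _ c, folded \<Delta>]
  let ?r = "rank n m c"
  have "?r 0 = 0" using PiE_mem[OF c, of 0] d n by (simp add: rank_def bnd_def)
  moreover have "0 \<le> ?r x" if "x < d * n" for x
    using PiE_mem[OF c, of x] that rank_nonneg_iff[OF n, of m c x] by simp
  moreover have "row n ?r i (Suc x) \<le> row n ?r i x + int m" if i: "i < d" for i x
  proof -
    let ?j = "x mod n"
    have j: "?j < n" "Suc x mod n < n" using n by simp_all
    have "0 \<le> int (hat_a d n m i ?j) - int (d * n) * c (i * n + ?j)"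
      using bnd_iff[OF i j(1)] le[OF i j(1)] by simp
    then obtain a where a: "int a = int (hat_a d n m i ?j) - int (d * n) * c (i * n + ?j)"
      using zero_le_imp_eq_int by metis
    have "a \<in> \<Delta>" using mem[OF i j(1) a] by simp
    then have "d * m + a \<in> \<Delta>" using inv Gam_gen[of "d * m"] by blast
    moreover have "int (d * m + a) = int (hat_a d n m i (Suc x mod n))
        - int (d * n) * (c (i * n + ?j) - int m * int (Suc ?j div n))"
      using hat_a_wrap[of d n m i x] a by (simp add: algebra_simps)
    note mem[OF i j(2) this]
    ultimately show ?thesis unfolding row_rank_step_iff[OF n] by blast
  qed
  moreover have "\<exists>x. row n ?r (Suc i) (Suc x) \<le> row n ?r i x + int m" if i: "Suc i < d" for i
  proof -
    obtain a where a: "a \<in> gens d n \<Delta>" "[a = i] (mod d)" "a + d * m + 1 \<in> \<Delta>"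
      using adm[of i] i by auto
    have "int a \<in> int ` gens d n \<Delta>" using a(1) by simp
    then obtain i' j where ij: "i' < d" "j < n" "int a = int (hat_a d n m i' j) - int (d * n) * c (i' * n + j)"
      unfolding gens by blast
    have "int a = int i' + int d * (int m * int j + int m * int n * int i' - int n * c (i' * n + j))"
      using ij(3) by (simp add: hat_a_int algebra_simps)
    then have "int a mod int d = int i'" using ij(1) by simp
    moreover have "int a mod int d = int i" using a(2) i by (simp add: cong_def zmod_int[symmetric])
    ultimately have i': "i' = i" by simp
    have j: "j mod n = j" "Suc j mod n < n" using ij(2) n by simp_all
    have "int (a + d * m + 1) = int (hat_a d n m (Suc i) (Suc j mod n))
        - int (d * n) * (c (i * n + j) + int m - int m * int (Suc j div n))"
      using hat_a_wrap[of d n m i j] ij(3) j(1) by (simp add: hat_a_Suc i' algebra_simps)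
    from mem[OF i j(2) this] a(3) show ?thesis
      by (intro exI[of _ j]) (simp only: row_rank_link_iff[OF n] j(1))
  qed
  ultimately show "assembled d n m 0 (rank n m (coord d n m \<Delta>))"
    unfolding coord assembled_bottom_iff[OF n d] by blast
qed

text \<open>
  Closure only needs checking for the three generators of the semigroup. For \<open>i = d - 1\<close> there is
  no next row; the elements whose membership is in question then lie in residue classes of row \<open>0\<close> and
  exceed the representatives of these classes, which belong to the set.
\<close>

lemma of_coord_Adm:
  assumes a: "assembled d n m 0 (rank n m c)" and ext: "c \<in> extensional {..<d * n}"
  shows "of_coord d n m c \<in> Adm d n m" "coord d n m (of_coord d n m c) = c"
proof -
  note A = a[unfolded assembled_bottom_iff[OF n d]]
  note c = assembled_bottom_bounds[OF a ext]
  show "coord d n m (of_coord d n m c) = c" by (rule coord_of_coord[OF d n coprime c])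
  have bounds: "0 \<le> c (i * n + j)" "c (i * n + j) \<le> int (bnd n m (i * n + j))"
    if "i < d" "j < n" for i j
    using PiE_mem[OF c, of "i * n + j"] index_less[OF that] by simp_all
  define \<Delta> where "\<Delta> = of_coord d n m c"
  have gens: "int ` gens d n \<Delta> =
      {int (hat_a d n m i j) - int (d * n) * c (i * n + j) | i j. i < d \<and> j < n}"
    unfolding \<Delta>_def by (rule gens_of_coord[OF d n coprime]) (rule bounds(2))
  note mem = mem_of_coord[OF d n coprime, of _ _ _ _ c, folded \<Delta>_def]
  note cover = hat_a_cover[OF d n coprime]
  have zero: "0 \<in> \<Delta>"
    using mem[of 0 0 0 0] bounds(1)[of 0 0] d n by (simp add: hat_a_def)
  have dn: "d * n + b \<in> \<Delta>" if "b \<in> \<Delta>" for b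
  proof -
    obtain i j t where b: "i < d" "j < n" "int b = int (hat_a d n m i j) - int (d * n) * t"
      using cover[of "int b"] by blast
    then have "int (d * n + b) = int (hat_a d n m i j) - int (d * n) * (t - 1)" by (simp add: algebra_simps)
    from mem[OF b(1,2) this] mem[OF b] that show ?thesis by simp
  qed
  have dm: "d * m + b \<in> \<Delta>" if "b \<in> \<Delta>" for b
  proof -
    obtain i j t where b: "i < d" "j < n" "int b = int (hat_a d n m i j) - int (d * n) * t"
      using cover[of "int b"] by blast
    have j: "j mod n = j" "Suc j mod n < n" using b(2) n by simp_all
    have "int (d * m + b) = int (hat_a d n m i (Suc j mod n))
        - int (d * n) * (t - int m * int (Suc j div n))"
      using hat_a_wrap[of d n m i j] b(3) j(1) by (simp add: algebra_simps)
    note mem' = mem[OF b(1) j(2) this]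
    have "row n (rank n m c) i (Suc j) \<le> row n (rank n m c) i j + int m" using A b(1) by blast
    then have "c (i * n + j) - int m * int (Suc j div n) \<le> c (i * n + Suc j mod n)"
      unfolding row_rank_step_iff[OF n] j(1) .
    then show ?thesis using mem' mem[OF b] that by linarith
  qed
  have dmn: "d * m * n + 1 + b \<in> \<Delta>" if "b \<in> \<Delta>" for b
  proof -
    obtain i j t where b: "i < d" "j < n" "int b = int (hat_a d n m i j) - int (d * n) * t" "int i = int b mod int d"
      using cover[of "int b"] by blast
    show ?thesis
    proof (cases "Suc i < d")
      case True
      have "int (d * m * n + 1 + b) = int (hat_a d n m (Suc i) j) - int (d * n) * t"
        using b(3) by (simp add: hat_a_Suc algebra_simps)
      from mem[OF True b(2) this] show ?thesis
        using mem[OF b(1-3)] that assembled_bottom_vertical[OF a True b(2)] by linarith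
    next
      \<comment> \<open>The residue class belongs to row \<open>0\<close>, whose representatives are below \<open>d * m * n\<close>.\<close>
      case False
      let ?b = "d * m * n + 1 + b"
      obtain i' j' t' where b': "i' < d" "j' < n" "int ?b = int (hat_a d n m i' j') - int (d * n) * t'"
        "int i' = int ?b mod int d"
        using cover[of "int ?b"] by blast
      have "i = d - 1" using False b(1) by simp
      then have "b mod d = d - 1" using b(4) by (simp add: zmod_int[symmetric])
      then have "Suc b mod d = 0" using d by (simp add: mod_Suc)
      moreover have "?b = Suc b + d * (m * n)" by simp
      then have "?b mod d = Suc b mod d" by (simp only: mod_mult_self2)
      moreover have "int i' = int (?b mod d)" using b'(4) by (simp only: zmod_int)
      ultimately have "i' = 0" by simp
      then have hat: "int (hat_a d n m i' j') = int d * int m * int j'" by (simp add: hat_a_def)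
      have "int d * int m * int j' \<le> int d * int m * int n" using b'(2) by (intro mult_left_mono) auto
      then have "int (d * n) * t' < 0" using b'(3) hat by simp
      then have "t' < 0" using d n by (simp add: mult_less_0_iff)
      then show ?thesis using mem[OF b'(1-3)] bounds(1)[OF b'(1,2)] by simp
    qed
  qed
  have "g \<in> Gam d n m \<Longrightarrow> b \<in> \<Delta> \<Longrightarrow> g + b \<in> \<Delta>" for g b
  proof (induction g arbitrary: b rule: Gam.induct)
    case (Gam_gen g)
    then show ?case using dn dm dmn by auto
  qed (simp_all add: add.assoc)
  moreover have "\<exists>a\<in>gens d n \<Delta>. [a = i] (mod d) \<and> a + d * m + 1 \<in> \<Delta>" if i: "i < d" for i
  proof -
    have generator: "\<exists>a\<in>gens d n \<Delta>. [a = i] (mod d) \<and>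
        int a = int (hat_a d n m i j) - int (d * n) * c (i * n + j)" if j: "j < n" for j
    proof -
      have "int (hat_a d n m i j) - int (d * n) * c (i * n + j) \<in> int ` gens d n \<Delta>"
        unfolding gens using i j by blast
      then obtain a where a: "a \<in> gens d n \<Delta>" "int a = int (hat_a d n m i j) - int (d * n) * c (i * n + j)"
        by auto
      have "int a = int i + int d * (int m * int j + int m * int n * int i - int n * c (i * n + j))"
        using a(2) by (simp add: hat_a_int algebra_simps)
      then have "int a mod int d = int i mod int d" by simp
      then have "[a = i] (mod d)" by (simp add: cong_def zmod_int[symmetric])
      then show ?thesis using a by blast
    qed
    show ?thesis
    proof (cases "Suc i < d")
      case True
      obtain x where x: "row n (rank n m c) (Suc i) (Suc x) \<le> row n (rank n m c) i x + int m"
        using A True by blast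
      have j: "x mod n < n" "Suc x mod n < n" using n by simp_all
      obtain a where a: "a \<in> gens d n \<Delta>" "[a = i] (mod d)"
        "int a = int (hat_a d n m i (x mod n)) - int (d * n) * c (i * n + x mod n)"
        using generator[OF j(1)] by blast
      have "int (a + d * m + 1) = int (hat_a d n m (Suc i) (Suc x mod n))
          - int (d * n) * (c (i * n + x mod n) + int m - int m * int (Suc (x mod n) div n))"
        using hat_a_wrap[of d n m i x] a(3) by (simp add: hat_a_Suc algebra_simps)
      from mem[OF True j(2) this] x have "a + d * m + 1 \<in> \<Delta>" unfolding row_rank_link_iff[OF n] by simp
      then show ?thesis using a by blast
    next
      case False
      \<comment> \<open>The generator congruent to \<open>- (d * m + 1)\<close> modulo \<open>d * n\<close> is taken to a multiple of \<open>d * n\<close>.\<close>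
      obtain i' j t where b: "i' < d" "j < n" "- int (d * m + 1) = int (hat_a d n m i' j) - int (d * n) * t"
        "int i' = (- int (d * m + 1)) mod int d"
        using cover[of "- int (d * m + 1)"] by blast
      have "- int (d * m + 1) = (int d - 1) + int d * (- int m - 1)" by (simp add: algebra_simps)
      then have "int i' = (int d - 1) mod int d" using b(4) by (simp only: mod_mult_self2)
      also have "\<dots> = int d - 1" using d by (intro mod_pos_pos_trivial) auto
      finally have i': "i' = i" using False i by simp
      obtain a where a: "a \<in> gens d n \<Delta>" "[a = i] (mod d)"
        "int a = int (hat_a d n m i j) - int (d * n) * c (i * n + j)"
        using generator[OF b(2)] by blast
      let ?s = "c (i * n + j) - t"
      have e: "int (a + d * m + 1) = int (hat_a d n m 0 0) - int (d * n) * ?s"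
        using b(3) a(3) i' by (simp add: hat_a_def algebra_simps)
      then have "int (d * n) * ?s = - int (a + d * m + 1)" by (simp add: hat_a_def)
      also have "\<dots> < 0" by (simp only: neg_less_0_iff_less of_nat_0_less_iff)
      finally have "int (d * n) * ?s < 0" .
      then have "?s < 0" using d n by (simp add: mult_less_0_iff)
      then have "a + d * m + 1 \<in> \<Delta>" using mem[OF d n e] bounds(1)[OF d n] by simp
      then show ?thesis using a by blast
    qed
  qed
  ultimately show "of_coord d n m c \<in> Adm d n m"
    unfolding \<Delta>_def[symmetric] Adm_def using zero by blast
qed

end

end

section \<open>The bijection\<close>

theorem proposition4p6:
  fixes d n m :: nat
  assumes "1 \<le> d" and "1 \<le> n" and "n < m" and "coprime m n"
  shows "(\<forall>\<Delta>\<in>Adm d n m. \<forall>u\<in>{1..d - 1}. pt_of d n m \<Delta> u = p_of d n m (Phi d n m \<Delta>) u) \<and>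
    (\<forall>D\<in>Yset d n m. \<forall>u\<in>{1..d - 1}. p_of d n m D u = pt_of d n m (Psi d n m D) u) \<and>
    Phi d n m \<in> Adm d n m \<rightarrow> Yset d n m \<and>
    Psi d n m \<in> Yset d n m \<rightarrow> Adm d n m \<and>
    (\<forall>\<Delta>\<in>Adm d n m. Psi d n m (Phi d n m \<Delta>) = \<Delta>) \<and>
    (\<forall>D\<in>Yset d n m. Phi d n m (Psi d n m D) = D) \<and>
    (\<forall>D\<in>Yset d n m. \<forall>\<Delta>. \<Delta> = Psi d n m D \<longrightarrow>
      (\<forall>j<n. \<forall>u\<in>{1..d - 1}. i_of d n m D j u = it_of d n m \<Delta> j u \<and>
                               s_step d n m D j u = st_step d n m \<Delta> j u) \<and>
      (\<forall>j<n. s_of d n m D j = st_of d n m \<Delta> j))"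
proof -
  have d: "0 < d" and n: "0 < n" using assms by simp_all
  note cop = \<open>coprime m n\<close>
  have Psi_ext: "Psi_coord d n m y \<in> extensional {..<d * n}"
    and Phi_ext: "Phi d n m \<Delta> \<in> extensional {..<d * n}" for y \<Delta>
    by (simp_all add: Psi_coord_def Phi_def)
  \<comment> \<open>Both maps are read off from one chain: its top is the rank family of \<open>D\<close>, its bottom that of \<open>Psi d n m D\<close>.\<close>
  have Y: "Psi d n m D \<in> Adm d n m \<and> Phi d n m (Psi d n m D) = D \<and>
      (\<forall>u. 1 \<le> u \<and> u < d \<longrightarrow> p_of d n m D u = pt_of d n m (Psi d n m D) u) \<and>
      (\<forall>j. s_of d n m D j = st_of d n m (Psi d n m D) j)" if D: "D \<in> Yset d n m" for D
  proof -
    have ext: "D \<in> extensional {..<d * n}" and a: "assembled d n m (d - 1) (rank n m D)"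
      using D by (simp_all add: Yset_iff[OF n d])
    obtain q where q: "chain d n m q" "q (d - 1) = rank n m D" using chain_from_top[OF n d a] .
    note r = q(2)[symmetric]
    have Psi: "rank n m (Psi_coord d n m D) = q 0" by (rule chain_Psi_coord[OF n d q(1) r ext])
    have "assembled d n m 0 (rank n m (Psi_coord d n m D))"
      unfolding Psi by (rule chainD(1)[OF q(1) d])
    note P = of_coord_Adm[OF d n cop this Psi_ext, folded Psi_def]
    have c: "rank n m (coord d n m (Psi d n m D)) = q 0" unfolding P(2) by (rule Psi)
    have "rank n m (Phi d n m (Psi d n m D)) = rank n m D"
      using chain_Phi[OF n d q(1) c] Psi_ext r by (simp add: P(2))
    then have "Phi d n m (Psi d n m D) = D" by (rule rank_inj[OF n])
    then show ?thesis
      using P(1) chain_p_of[OF n d q(1) r] chain_pt_of[OF n d q(1) c]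
        chain_s_of[OF n d q(1) r] chain_st_of[OF n d q(1) c] by simp
  qed
  have A: "Phi d n m \<Delta> \<in> Yset d n m \<and> Psi d n m (Phi d n m \<Delta>) = \<Delta>" if \<Delta>: "\<Delta> \<in> Adm d n m" for \<Delta>
  proof -
    note C = Adm_coord[OF d n cop \<Delta>]
    obtain q where q: "chain d n m q" "q 0 = rank n m (coord d n m \<Delta>)"
      using chain_from_bottom[OF n C(3)] .
    have Phi: "rank n m (Phi d n m \<Delta>) = q (d - 1)"
      by (rule chain_Phi[OF n d q(1) q(2)[symmetric] C(2)])
    have "assembled d n m (d - 1) (rank n m (Phi d n m \<Delta>))"
      unfolding Phi using chainD(1)[OF q(1)] d by simp
    then have "Phi d n m \<Delta> \<in> Yset d n m" using Phi_ext by (simp add: Yset_iff[OF n d])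
    moreover have "rank n m (Psi_coord d n m (Phi d n m \<Delta>)) = rank n m (coord d n m \<Delta>)"
      using chain_Psi_coord[OF n d q(1) Phi Phi_ext] q(2) by simp
    then have "Psi_coord d n m (Phi d n m \<Delta>) = coord d n m \<Delta>" by (rule rank_inj[OF n])
    then have "Psi d n m (Phi d n m \<Delta>) = \<Delta>" using C(1) by (simp add: Psi_def)
    ultimately show ?thesis by blast
  qed
  have p: "p_of d n m D u = pt_of d n m (Psi d n m D) u" if "D \<in> Yset d n m" "u \<in> {1..d - 1}" for D u
    using Y[OF that(1)] that(2) by auto
  have "pt_of d n m \<Delta> u = p_of d n m (Phi d n m \<Delta>) u" if "\<Delta> \<in> Adm d n m" "u \<in> {1..d - 1}" for \<Delta> u
    using p[of "Phi d n m \<Delta>" u] A[OF that(1)] that(2) by simp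
  moreover have "i_of d n m D j u = it_of d n m (Psi d n m D) j u"
    "s_step d n m D j u = st_step d n m (Psi d n m D) j u"
    if "D \<in> Yset d n m" "u \<in> {1..d - 1}" for D j u
    using p[OF that] by (simp_all add: i_of_def it_of_def s_step_def st_step_def)
  ultimately show ?thesis using Y A p by (auto simp del: One_nat_def)
qed

end
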